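(* Let $M$ be a $(k+1)$-tape, well-formed, oracle QTM in normal form with a single query tape that halts in time $T(x)$ on input $x$ (a $k$-tuple of strings). Let $A$ be an oracle. There exists a $(k+2)$-tape, well-formed, oracle QTM $M'$ with two query tapes, running in time $7T(x)$ on input $x$, such that $M'$ makes exactly $T(x)$ queries along each computation path and $\mu_{M'}^{(A,A)}(x)=\mu_M^A(x)$.
   Context: A $(k+m)$-tape oracle QTM with $m$ query tapes is $M=(Q,\{q_0\},Q_f,Q_p,Q_a,\Sigma_1\times\cdots\times\Sigma_{k+m},\delta)$: $Q$ is a finite set of states containing an initial state $q_0$, a set $Q_f$ of final states, pre-query states $Q_p=\{q_p^1,\dots,q_p^m\}$ and post-query states $Q_a=\{q_a^1,\dots,q_a^m\}$; each $\Sigma_i$ is a finite alphabet with blank $\#$, and $\{0,1\}\subseteq\Sigma_{k+i}$ for $1\le i\le m$; with $\tilde\Sigma=\Sigma_1\times\cdots\times\Sigma_{k+m}$, the transition function is $\delta:(Q\setminus Q_p)\times\tilde\Sigma\to\mathbb{C}^{Q\times\tilde\Sigma\times\{R,N,L\}^{k+m}}$. Tapes are two-way infinite, with cells indexed by $\mathbb{Z}$ (start cell $0$), one head each; tape $k+i$ is the $i$th query tape. A configuration consists of a state, tape contents with finitely many nonblank cells, and head positions; it is final if its state is in $Q_f$. For a series of oracles $\mathcal{A}=(A_i)_{1\le i\le m}$, $A_i\subseteq(\Sigma_{k+i})^*$ (for $m=1$ a single oracle $A$), the time-evolution operator (a linear operator on finite linear combinations of configurations, which are orthonormal) maps a configuration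 in state $p\notin Q_p$ scanning $\sigma$ to $\sum_{q,\tau,d}\delta(p,\sigma,q,\tau,d)c_{q,\tau,d}$ (write $\tau$, enter $q$, move heads by $d\in\{R,N,L\}^{k+m}$; $R,L,N$ = right, left, no move). A configuration in state $q_p^i$ makes a query in one step: if the nonblank content of the $i$th query tape is a single block $y\circ b$ with $b\in\{0,1\}$ ($\circ$ is concatenation; $y$ is the query word), the state becomes $q_a^i$ and the block becomes $y\circ(b\oplus A_i(y))$, where $A_i(y)=1$ iff $y\in A_i$, nothing else changing; otherwise only the state changes to $q_a^i$. $M$ is well-formed if its time-evolution operator preserves the $L_2$-norm (for all oracles). $M$ is in normal form if for every final state $q_f^i$ there is a direction tuple $d_i$ with $\delta(q_f^i,\sigma)=|q_0\rangle|\sigma\rangle|d_i\rangle$ for all $\sigma$. On input strings (over nonblank symbols) the initial configuration has state $q_0$, all heads in start cells, $x$ written rightward from the start cells of tapes $1$ to $k$, other tapes empty. The running time is the minimal $T$ such that at time $T$ all computation paths are in final configurations (all configurations with nonzero amplitude after $T$ steps are final); "halts (runs) in time $T$" means the running time exists and equals $T$; halting and numbers of queries (counted up to the running time) are relative to the oracles in use ($A$ for $M$, $(A,A)$ for $M'$). $\mu_M^{\mathcal{A}}(x)$ is the acceptance probability of $M$ on $x$ with oracles $\mathcal{A}$: the probability that observing the final superposition (at the running time) shows $1$ in the start cell of a designated output tape (component); for a machine asserted to exist, this designation is part of the machine. *)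

theory Defs
  imports Complex_Main "HOL-Analysis.L2_Norm"
begin

text \<open>
  All finite alphabets are finite subsets of one countable universe of symbols, in which the blank
  and the two bits are distinct; \<open>Bit False\<close> is 0 and \<open>Bit True\<close> is 1.
\<close>

datatype symbol = Blank | Bit bool | Letter nat

datatype dir = MoveR | MoveN | MoveL

fun shift :: "dir \<Rightarrow> int" where
  "shift MoveR = 1"
| "shift MoveN = 0"
| "shift MoveL = - 1"

type_synonym tape = "int \<Rightarrow> symbol"

text \<open>
  Tuples over the tapes are lists, indexed from 0: with \<open>k\<close> ordinary and \<open>m\<close> query tapes, the
  query tapes are those with index \<open>k, \<dots>, k + m - 1\<close>. The value \<open>\<delta>(p, \<sigma>, q, \<tau>, d)\<close> is
  \<open>delta M p \<sigma> q \<tau> d\<close>. Its values for \<open>p\<close> pre-query, or for arguments outside the state set or the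
  alphabets, are never used. The designated output tape is part of the machine.
\<close>

record 'q oqtm =
  states :: "'q set"
  init :: 'q
  final :: "'q set"
  pre :: "'q list"
  post :: "'q list"
  alph :: "symbol set list"
  delta :: "'q \<Rightarrow> symbol list \<Rightarrow> 'q \<Rightarrow> symbol list \<Rightarrow> dir list \<Rightarrow> complex"
  out :: nat

definition ntapes :: "'q oqtm \<Rightarrow> nat" where
  "ntapes M = length (alph M)"

definition nqueries :: "'q oqtm \<Rightarrow> nat" where
  "nqueries M = length (pre M)"

definition nplain :: "'q oqtm \<Rightarrow> nat" where
  "nplain M = ntapes M - nqueries M"

definition oracle_qtm :: "nat \<Rightarrow> nat \<Rightarrow> 'q oqtm \<Rightarrow> bool" where
  "oracle_qtm k m M \<longleftrightarrow>
     finite (states M) \<and> init M \<in> states M \<and> final M \<subseteq> states M \<and>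
     length (pre M) = m \<and> distinct (pre M) \<and> set (pre M) \<subseteq> states M \<and>
     length (post M) = m \<and> distinct (post M) \<and> set (post M) \<subseteq> states M \<and>
     length (alph M) = k + m \<and>
     (\<forall>i<k + m. finite (alph M ! i) \<and> Blank \<in> alph M ! i) \<and>
     (\<forall>i<m. {Bit False, Bit True} \<subseteq> alph M ! (k + i)) \<and>
     out M < k + m"

definition oracles :: "'q oqtm \<Rightarrow> symbol list set list \<Rightarrow> bool" where
  "oracles M As \<longleftrightarrow> length As = nqueries M \<and>
     (\<forall>i<nqueries M. As ! i \<subseteq> lists (alph M ! (nplain M + i)))"

record 'q config =
  cstate :: 'q
  tapes :: "tape list"
  heads :: "int list"

definition configs :: "'q oqtm \<Rightarrow> 'q config set" where
  "configs M = {c. cstate c \<in> states M \<and>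
     length (tapes c) = ntapes M \<and> length (heads c) = ntapes M \<and>
     (\<forall>i<ntapes M. range (tapes c ! i) \<subseteq> alph M ! i \<and> finite {z. (tapes c ! i) z \<noteq> Blank})}"

definition word_at :: "int \<Rightarrow> symbol list \<Rightarrow> tape" where
  "word_at s w = (\<lambda>z. if s \<le> z \<and> z < s + int (length w) then w ! nat (z - s) else Blank)"

text \<open>
  The relation \<open>query_rel A t t'\<close> says that the nonblank content of \<open>t\<close> is a single block consisting
  of a query word followed by a bit, and \<open>t'\<close> arises by adding the answer of \<open>A\<close> to that bit modulo 2.
\<close>

definition query_rel :: "symbol list set \<Rightarrow> tape \<Rightarrow> tape \<Rightarrow> bool" where
  "query_rel A t t' \<longleftrightarrow> (\<exists>s y b. Blank \<notin> set y \<and>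
     t = word_at s (y @ [Bit b]) \<and> t' = word_at s (y @ [Bit (b \<noteq> (y \<in> A))]))"

definition query_tape :: "symbol list set \<Rightarrow> tape \<Rightarrow> tape" where
  "query_tape A t = (if \<exists>t'. query_rel A t t' then THE t'. query_rel A t t' else t)"

lemma word_at_inject:
  assumes "word_at s v = word_at s' w" "Blank \<notin> set v" "Blank \<notin> set w" "v \<noteq> []" "w \<noteq> []"
  shows "s = s' \<and> v = w"
proof -
  have supp: "{z. word_at r u z \<noteq> Blank} = {r..<r + int (length u)}" if "Blank \<notin> set u" for r u
  proof -
    have "u ! nat (z - r) \<noteq> Blank" if "r \<le> z" "z < r + int (length u)" for z
    proof -
      have "nat (z - r) < length u" using that by linarith
      then show ?thesis using \<open>Blank \<notin> set u\<close> nth_mem by metis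
    qed
    then show ?thesis by (auto simp: word_at_def)
  qed
  have eq: "{s..<s + int (length v)} = {s'..<s' + int (length w)}"
    using supp[of v s] supp[of w s'] assms by simp
  have pos: "length v > 0" "length w > 0" using assms by auto
  have s: "s = s'" and "s + int (length v) = s' + int (length w)"
    using eq pos by (auto simp: atLeastLessThan_eq_iff)
  then have len: "length v = length w" by simp
  have "v ! i = w ! i" if "i < length v" for i
    using fun_cong[OF assms(1), of "s + int i"] that s len by (simp add: word_at_def)
  then show ?thesis using s len by (simp add: nth_equalityI)
qed

lemma query_tape_block:
  assumes "Blank \<notin> set y"
  shows "query_tape A (word_at s (y @ [Bit b])) = word_at s (y @ [Bit (b \<noteq> (y \<in> A))])"
proof -
  have "t' = word_at s (y @ [Bit (b \<noteq> (y \<in> A))])"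
    if rel: "query_rel A (word_at s (y @ [Bit b])) t'" for t'
  proof -
    obtain s' y' b' where y': "Blank \<notin> set y'"
        "word_at s (y @ [Bit b]) = word_at s' (y' @ [Bit b'])"
        "t' = word_at s' (y' @ [Bit (b' \<noteq> (y' \<in> A))])"
      using rel unfolding query_rel_def by blast
    have "s = s' \<and> y @ [Bit b] = y' @ [Bit b']"
      by (rule word_at_inject) (use y' assms in simp_all)
    then show ?thesis using y'(3) by simp
  qed
  moreover have "query_rel A (word_at s (y @ [Bit b])) (word_at s (y @ [Bit (b \<noteq> (y \<in> A))]))"
    using assms unfolding query_rel_def by blast
  ultimately have "(THE t'. query_rel A (word_at s (y @ [Bit b])) t') =
      word_at s (y @ [Bit (b \<noteq> (y \<in> A))])" and "\<exists>t'. query_rel A (word_at s (y @ [Bit b])) t'"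
    by (blast intro: the_equality)+
  then show ?thesis unfolding query_tape_def by simp
qed

lemma query_tape_no_block:
  assumes "\<nexists>s y b. Blank \<notin> set y \<and> t = word_at s (y @ [Bit b])"
  shows "query_tape A t = t"
  using assms unfolding query_tape_def query_rel_def by auto

definition query_config :: "'q oqtm \<Rightarrow> symbol list set list \<Rightarrow> nat \<Rightarrow> 'q config \<Rightarrow> 'q config" where
  "query_config M As i c =
     c\<lparr>cstate := post M ! i,
       tapes := (tapes c)[nplain M + i := query_tape (As ! i) (tapes c ! (nplain M + i))]\<rparr>"

definition scanned :: "'q config \<Rightarrow> symbol list" where
  "scanned c = map2 (\<lambda>t h. t h) (tapes c) (heads c)"

definition move_config :: "'q config \<Rightarrow> 'q \<Rightarrow> symbol list \<Rightarrow> dir list \<Rightarrow> 'q config" where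
  "move_config c q \<tau> d =
     \<lparr>cstate = q,
      tapes = map (\<lambda>i. (tapes c ! i)(heads c ! i := \<tau> ! i)) [0..<length (tapes c)],
      heads = map (\<lambda>i. heads c ! i + shift (d ! i)) [0..<length (heads c)]\<rparr>"

definition targets :: "'q oqtm \<Rightarrow> ('q \<times> symbol list \<times> dir list) set" where
  "targets M = states M \<times> listset (alph M) \<times> {d. length d = ntapes M}"

text \<open>
  A superposition is a function of finite support from configurations to amplitudes; the sums over
  the support below are meant for such functions only.
\<close>

type_synonym 'q superpos = "'q config \<Rightarrow> complex"

definition ket :: "'q config \<Rightarrow> 'q superpos" where
  "ket c = (\<lambda>c'. if c' = c then 1 else 0)"

definition step :: "'q oqtm \<Rightarrow> symbol list set list \<Rightarrow> 'q config \<Rightarrow> 'q superpos" where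
  "step M As c =
     (if cstate c \<in> set (pre M)
      then ket (query_config M As (THE i. i < nqueries M \<and> pre M ! i = cstate c) c)
      else (\<lambda>c'. \<Sum>(q, \<tau>, d)\<in>targets M.
              delta M (cstate c) (scanned c) q \<tau> d * ket (move_config c q \<tau> d) c'))"

definition evolve :: "'q oqtm \<Rightarrow> symbol list set list \<Rightarrow> 'q superpos \<Rightarrow> 'q superpos" where
  "evolve M As \<phi> = (\<lambda>c'. \<Sum>c | \<phi> c \<noteq> 0. \<phi> c * step M As c c')"

definition superpositions :: "'q oqtm \<Rightarrow> 'q superpos set" where
  "superpositions M = {\<phi>. finite {c. \<phi> c \<noteq> 0} \<and> {c. \<phi> c \<noteq> 0} \<subseteq> configs M}"

definition l2norm :: "'q superpos \<Rightarrow> real" where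
  "l2norm \<phi> = L2_set (\<lambda>c. cmod (\<phi> c)) {c. \<phi> c \<noteq> 0}"

definition well_formed :: "'q oqtm \<Rightarrow> bool" where
  "well_formed M \<longleftrightarrow>
     (\<forall>As. oracles M As \<longrightarrow> (\<forall>\<phi>\<in>superpositions M. l2norm (evolve M As \<phi>) = l2norm \<phi>))"

text \<open>
  As \<open>\<delta>\<close> has no pre-query states in its domain, the condition on \<open>\<delta>(q, \<sigma>)\<close> for final \<open>q\<close> includes
  that \<open>q\<close> is not a pre-query state.
\<close>

definition normal_form :: "'q oqtm \<Rightarrow> bool" where
  "normal_form M \<longleftrightarrow> (\<forall>q\<in>final M. q \<notin> set (pre M) \<and>
     (\<exists>d. length d = ntapes M \<and> (\<forall>\<sigma>\<in>listset (alph M). \<forall>(q', \<tau>, d')\<in>targets M.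
        delta M q \<sigma> q' \<tau> d' = (if (q', \<tau>, d') = (init M, \<sigma>, d) then 1 else 0))))"

definition inputs :: "'q oqtm \<Rightarrow> symbol list list set" where
  "inputs M = {x. length x = nplain M \<and> (\<forall>i<nplain M. x ! i \<in> lists (alph M ! i - {Blank}))}"

definition initial :: "'q oqtm \<Rightarrow> symbol list list \<Rightarrow> 'q config" where
  "initial M x =
     \<lparr>cstate = init M,
      tapes = map (word_at 0) x @ replicate (nqueries M) (\<lambda>_. Blank),
      heads = replicate (ntapes M) 0\<rparr>"

definition superpos_at ::
    "'q oqtm \<Rightarrow> symbol list set list \<Rightarrow> symbol list list \<Rightarrow> nat \<Rightarrow> 'q superpos" where
  "superpos_at M As x t = (evolve M As ^^ t) (ket (initial M x))"

definition all_final_at ::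
    "'q oqtm \<Rightarrow> symbol list set list \<Rightarrow> symbol list list \<Rightarrow> nat \<Rightarrow> bool" where
  "all_final_at M As x t \<longleftrightarrow> (\<forall>c. superpos_at M As x t c \<noteq> 0 \<longrightarrow> cstate c \<in> final M)"

definition running_time :: "'q oqtm \<Rightarrow> symbol list set list \<Rightarrow> symbol list list \<Rightarrow> nat" where
  "running_time M As x = (LEAST t. all_final_at M As x t)"

definition halts_in_time ::
    "'q oqtm \<Rightarrow> symbol list set list \<Rightarrow> symbol list list \<Rightarrow> nat \<Rightarrow> bool" where
  "halts_in_time M As x T \<longleftrightarrow> (\<exists>t. all_final_at M As x t) \<and> running_time M As x = T"

text \<open>
  Each step of a computation path has nonzero amplitude; interference between paths is disregarded.
\<close>

definition computation_path ::
    "'q oqtm \<Rightarrow> symbol list set list \<Rightarrow> symbol list list \<Rightarrow> 'q config list \<Rightarrow> bool" where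
  "computation_path M As x cs \<longleftrightarrow>
     length cs = Suc (running_time M As x) \<and> cs ! 0 = initial M x \<and>
     (\<forall>i<running_time M As x. step M As (cs ! i) (cs ! Suc i) \<noteq> 0)"

definition path_queries ::
    "'q oqtm \<Rightarrow> symbol list set list \<Rightarrow> symbol list list \<Rightarrow> 'q config list \<Rightarrow> nat" where
  "path_queries M As x cs = card {i. i < running_time M As x \<and> cstate (cs ! i) \<in> set (pre M)}"

definition accept_prob :: "'q oqtm \<Rightarrow> symbol list set list \<Rightarrow> symbol list list \<Rightarrow> real" where
  "accept_prob M As x =
     (let \<phi> = superpos_at M As x (running_time M As x)
      in \<Sum>c | \<phi> c \<noteq> 0 \<and> (tapes c ! out M) 0 = Bit True. (cmod (\<phi> c))\<^sup>2)"

end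

theory Submission
  imports Defs
begin

text \<open>
  Each step of \<open>M\<close> is stretched to seven steps of \<open>M'\<close> that contain exactly one query. A query step
  of \<open>M\<close> is preceded by six idle steps. Before any other step the state of \<open>M\<close> is written as a letter
  on the second query tape, whose head never moves; the machine then makes a dummy query on that tape,
  which changes nothing because the block does not end in a bit, and afterwards restores the state
  from the letter. Off the intended tape contents, the idle, load and unload moves are completed to an
  injective partial map on pairs (state, symbol), so that the images of the configurations stay
  orthonormal; this is equivalent to well-formedness.
\<close>

text \<open>A query tape owns just one pre-query and one post-query state, so a dummy query started
  from an arbitrary state would forget that state. It has to be kept on a tape, and the second query
  tape is the only one that the simulated step does not use. Loading, querying, unloading and the
  step itself take four moves; three delays before them make up the required seven. The main burden
  is that well-formedness concerns every configuration and every pair of oracles, hence arbitrary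
  contents of the second query tape. The target states keep the images orthogonal: only the dummy
  query enters state 1, only simulated steps of \<open>M\<close> enter level 0, and the remaining
  moves land elsewhere. Levels also pin down the running time, because final states occur only at
  level 0.\<close>

lemma listset_iff:
  "xs \<in> listset As \<longleftrightarrow> length xs = length As \<and> (\<forall>i<length As. xs ! i \<in> As ! i)"
proof (induction As arbitrary: xs)
  case (Cons A As)
  show ?case
    by (cases xs) (auto simp: set_Cons_def Cons.IH less_Suc_eq_0_disj)
qed simp

lemma finite_listset:
  assumes "\<And>i. i < length As \<Longrightarrow> finite (As ! i)"
  shows "finite (listset As)"
  using assms
proof (induction As)
  case (Cons A As)
  have "finite A" using Cons.prems[of 0] by simp
  moreover have "finite (listset As)" using Cons.prems[of "Suc _"] by (intro Cons.IH) simp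
  moreover have "listset (A # As) = (\<lambda>(x, xs). x # xs) ` (A \<times> listset As)"
    by (auto simp: set_Cons_def)
  ultimately show ?case by simp
qed simp

lemma finite_dir_lists: "finite {d :: dir list. length d = n}"
proof -
  have "(UNIV :: dir set) = {MoveR, MoveN, MoveL}" using dir.exhaust by blast
  then have "finite (UNIV :: dir set)" by (metis finite.emptyI finite.insertI)
  from finite_lists_length_eq[OF this, of n] show ?thesis by simp
qed

section \<open>Linear operators on superpositions\<close>

definition supp :: "('a \<Rightarrow> complex) \<Rightarrow> 'a set" where
  "supp \<phi> = {c. \<phi> c \<noteq> 0}"

text \<open>The Hermitian inner product, linear in the first argument; terms outside the support of
  \<open>\<phi>\<close> vanish, so the sum over it captures the whole form.\<close>

definition ip :: "('a \<Rightarrow> complex) \<Rightarrow> ('a \<Rightarrow> complex) \<Rightarrow> complex" where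
  "ip \<phi> \<psi> = (\<Sum>c\<in>supp \<phi>. \<phi> c * cnj (\<psi> c))"

definition lin :: "('a \<Rightarrow> 'b \<Rightarrow> complex) \<Rightarrow> ('a \<Rightarrow> complex) \<Rightarrow> 'b \<Rightarrow> complex" where
  "lin F \<phi> = (\<lambda>c'. \<Sum>c\<in>supp \<phi>. \<phi> c * F c c')"

text \<open>The linear extension of \<open>f\<close>: amplitudes of configurations with a common
  image add up. For injective \<open>f\<close> it merely renames basis vectors.\<close>

definition push :: "('q config \<Rightarrow> 'r config) \<Rightarrow> 'q superpos \<Rightarrow> 'r superpos" where
  "push f = lin (\<lambda>c. ket (f c))"

lemma evolve_eq_lin: "evolve M As = lin (step M As)"
  by (simp add: evolve_def lin_def supp_def fun_eq_iff)

lemma supp_ket [simp]: "supp (ket c) = {c}"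
  by (auto simp: supp_def ket_def)

lemma lin_eq_sum:
  assumes "finite S" "supp \<phi> \<subseteq> S"
  shows "lin F \<phi> c' = (\<Sum>c\<in>S. \<phi> c * F c c')"
  unfolding lin_def by (rule sum.mono_neutral_left) (use assms in \<open>auto simp: supp_def\<close>)

lemma ip_eq_sum:
  assumes "finite S" "supp \<phi> \<subseteq> S"
  shows "ip \<phi> \<psi> = (\<Sum>c\<in>S. \<phi> c * cnj (\<psi> c))"
  unfolding ip_def by (rule sum.mono_neutral_left) (use assms in \<open>auto simp: supp_def\<close>)

lemma lin_ket [simp]: "lin F (ket c) = F c"
  unfolding lin_def supp_ket by (simp add: ket_def)

lemma lin_cong:
  assumes "\<And>c. c \<in> supp \<phi> \<Longrightarrow> F c = G c"
  shows "lin F \<phi> = lin G \<phi>"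
  unfolding lin_def using assms by simp

lemma supp_lin: "supp (lin F \<phi>) \<subseteq> (\<Union>c\<in>supp \<phi>. supp (F c))"
proof
  fix c' assume "c' \<in> supp (lin F \<phi>)"
  then have "(\<Sum>c\<in>supp \<phi>. \<phi> c * F c c') \<noteq> 0" by (simp add: supp_def lin_def)
  then obtain c where "c \<in> supp \<phi>" "\<phi> c * F c c' \<noteq> 0" by (meson sum.neutral)
  then show "c' \<in> (\<Union>c\<in>supp \<phi>. supp (F c))" by (auto simp: supp_def)
qed

lemma finite_supp_lin:
  assumes "finite (supp \<phi>)" "\<And>c. c \<in> supp \<phi> \<Longrightarrow> finite (supp (F c))"
  shows "finite (supp (lin F \<phi>))"
  by (rule finite_subset[OF supp_lin]) (use assms in auto)

lemma lin_sum:
  assumes "finite I" "\<And>i. i \<in> I \<Longrightarrow> finite (supp (\<psi> i))"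
  shows "lin F (\<lambda>c. \<Sum>i\<in>I. a i * \<psi> i c) = (\<lambda>c'. \<Sum>i\<in>I. a i * lin F (\<psi> i) c')"
proof
  fix c'
  define S where "S = (\<Union>i\<in>I. supp (\<psi> i))"
  have S: "finite S" unfolding S_def using assms by auto
  have "supp (\<lambda>c. \<Sum>i\<in>I. a i * \<psi> i c) \<subseteq> S"
  proof
    fix c assume "c \<in> supp (\<lambda>c. \<Sum>i\<in>I. a i * \<psi> i c)"
    then have "(\<Sum>i\<in>I. a i * \<psi> i c) \<noteq> 0" by (simp add: supp_def)
    then obtain i where "i \<in> I" "a i * \<psi> i c \<noteq> 0" by (meson sum.neutral)
    then show "c \<in> S" by (auto simp: supp_def S_def)
  qed
  then have "lin F (\<lambda>c. \<Sum>i\<in>I. a i * \<psi> i c) c' = (\<Sum>c\<in>S. (\<Sum>i\<in>I. a i * \<psi> i c) * F c c')"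
    using S by (rule lin_eq_sum[rotated])
  also have "\<dots> = (\<Sum>i\<in>I. \<Sum>c\<in>S. a i * \<psi> i c * F c c')"
    by (subst sum.swap) (simp add: sum_distrib_right)
  also have "\<dots> = (\<Sum>i\<in>I. a i * lin F (\<psi> i) c')"
  proof (rule sum.cong[OF refl])
    fix i assume "i \<in> I"
    then have "lin F (\<psi> i) c' = (\<Sum>c\<in>S. \<psi> i c * F c c')"
      by (intro lin_eq_sum[OF S]) (auto simp: S_def)
    then show "(\<Sum>c\<in>S. a i * \<psi> i c * F c c') = a i * lin F (\<psi> i) c'"
      by (simp add: sum_distrib_left mult.assoc)
  qed
  finally show "lin F (\<lambda>c. \<Sum>i\<in>I. a i * \<psi> i c) c' = (\<Sum>i\<in>I. a i * lin F (\<psi> i) c')" .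
qed

lemma lin_lin:
  assumes "finite (supp \<phi>)" "\<And>c. c \<in> supp \<phi> \<Longrightarrow> finite (supp (G c))"
  shows "lin F (lin G \<phi>) = lin (\<lambda>c. lin F (G c)) \<phi>"
  using lin_sum[OF assms, where a = \<phi> and F = F] by (simp add: lin_def[of _ \<phi>])

lemma push_ket [simp]: "push f (ket c) = ket (f c)"
  by (simp add: push_def)

lemma supp_push_subset: "supp (push f \<phi>) \<subseteq> f ` supp \<phi>"
  using supp_lin[of "\<lambda>c. ket (f c)" \<phi>] by (auto simp: push_def)

text \<open>Injectivity is asked at \<open>c\<close> as well, so that the equation also covers
  points where \<open>\<phi>\<close> vanishes.\<close>

lemma push_apply:
  assumes "inj_on f (insert c (supp \<phi>))" "finite (supp \<phi>)"
  shows "push f \<phi> (f c) = \<phi> c"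
proof -
  have "push f \<phi> (f c) = (\<Sum>c'\<in>insert c (supp \<phi>). \<phi> c' * ket (f c') (f c))"
    unfolding push_def using assms(2) by (intro lin_eq_sum) auto
  also have "\<dots> = (\<Sum>c'\<in>insert c (supp \<phi>). if c' = c then \<phi> c else 0)"
    by (rule sum.cong) (use assms(1) in \<open>auto simp: ket_def dest: inj_onD\<close>)
  finally show ?thesis using assms(2) by simp
qed

lemma supp_push:
  assumes "inj_on f (supp \<phi>)" "finite (supp \<phi>)"
  shows "supp (push f \<phi>) = f ` supp \<phi>"
proof (intro equalityI supp_push_subset subsetI)
  fix c' assume "c' \<in> f ` supp \<phi>"
  then obtain c where c: "c \<in> supp \<phi>" "c' = f c" by blast
  then have "push f \<phi> c' = \<phi> c" using assms by (simp add: push_apply insert_absorb)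
  then show "c' \<in> supp (push f \<phi>)" using c by (simp add: supp_def)
qed

lemma ip_push:
  assumes "inj_on f (supp \<phi> \<union> supp \<psi>)" "finite (supp \<phi>)" "finite (supp \<psi>)"
  shows "ip (push f \<phi>) (push f \<psi>) = ip \<phi> \<psi>"
proof -
  have inj: "inj_on f (supp \<phi>)" using assms(1) by (rule inj_on_subset) blast
  have "push f \<phi> (f c) = \<phi> c \<and> push f \<psi> (f c) = \<psi> c" if "c \<in> supp \<phi>" for c
    using that assms by (auto intro!: push_apply inj_on_subset[OF assms(1)])
  then show ?thesis
    unfolding ip_def[of "push f \<phi>"] supp_push[OF inj assms(2)] sum.reindex[OF inj]
    by (simp add: ip_def)
qed

lemma ip_disjoint:
  assumes "supp \<phi> \<inter> supp \<psi> = {}"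
  shows "ip \<phi> \<psi> = 0"
  unfolding ip_def by (rule sum.neutral) (use assms in \<open>auto simp: supp_def\<close>)

lemma ip_ket: "ip (ket c) (ket c') = (if c = c' then 1 else 0)"
  unfolding ip_def supp_ket by (simp add: ket_def)

lemma ip_commute:
  assumes "finite (supp \<phi>)" "finite (supp \<psi>)"
  shows "ip \<psi> \<phi> = cnj (ip \<phi> \<psi>)"
  using ip_eq_sum[of "supp \<phi> \<union> supp \<psi>" \<phi> \<psi>] ip_eq_sum[of "supp \<phi> \<union> supp \<psi>" \<psi> \<phi>] assms
  by (simp add: mult.commute)

lemma ip_lin_lin:
  assumes "finite (supp \<phi>)" "finite (supp \<psi>)"
    and "\<And>c. c \<in> supp \<phi> \<union> supp \<psi> \<Longrightarrow> finite (supp (F c))"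
  shows "ip (lin F \<phi>) (lin F \<psi>) =
    (\<Sum>c\<in>supp \<phi>. \<Sum>c'\<in>supp \<psi>. \<phi> c * cnj (\<psi> c') * ip (F c) (F c'))"
proof -
  define S where "S = (\<Union>c\<in>supp \<phi>. supp (F c))"
  have S: "finite S" unfolding S_def using assms by auto
  have "ip (lin F \<phi>) (lin F \<psi>) = (\<Sum>s\<in>S. lin F \<phi> s * cnj (lin F \<psi> s))"
    using S unfolding S_def by (intro ip_eq_sum supp_lin)
  also have "\<dots> = (\<Sum>s\<in>S. \<Sum>c\<in>supp \<phi>. \<Sum>c'\<in>supp \<psi>. \<phi> c * F c s * (cnj (\<psi> c') * cnj (F c' s)))"
    by (simp add: lin_def sum_product)
  also have "\<dots> = (\<Sum>c\<in>supp \<phi>. \<Sum>s\<in>S. \<Sum>c'\<in>supp \<psi>. \<phi> c * F c s * (cnj (\<psi> c') * cnj (F c' s)))"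
    by (rule sum.swap)
  also have "\<dots> = (\<Sum>c\<in>supp \<phi>. \<Sum>c'\<in>supp \<psi>. \<Sum>s\<in>S. \<phi> c * F c s * (cnj (\<psi> c') * cnj (F c' s)))"
    by (rule sum.cong[OF refl]) (rule sum.swap)
  also have "\<dots> = (\<Sum>c\<in>supp \<phi>. \<Sum>c'\<in>supp \<psi>. \<phi> c * cnj (\<psi> c') * ip (F c) (F c'))"
  proof (intro sum.cong refl)
    fix c c' assume c: "c \<in> supp \<phi>" "c' \<in> supp \<psi>"
    then have "ip (F c) (F c') = (\<Sum>s\<in>S. F c s * cnj (F c' s))"
      by (intro ip_eq_sum[OF S]) (auto simp: S_def)
    then show "(\<Sum>s\<in>S. \<phi> c * F c s * (cnj (\<psi> c') * cnj (F c' s))) =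
        \<phi> c * cnj (\<psi> c') * ip (F c) (F c')"
      by (simp add: sum_distrib_left ac_simps)
  qed
  finally show ?thesis .
qed

lemma l2norm_power2:
  "complex_of_real ((l2norm \<phi>)\<^sup>2) = ip \<phi> \<phi>"
proof -
  have "(l2norm \<phi>)\<^sup>2 = (\<Sum>c\<in>supp \<phi>. (cmod (\<phi> c))\<^sup>2)"
    unfolding l2norm_def L2_set_def supp_def by (simp add: sum_nonneg)
  then show ?thesis by (simp add: ip_def complex_norm_square del: of_real_power)
qed

lemma l2norm_eq_iff: "l2norm \<phi> = l2norm \<psi> \<longleftrightarrow> ip \<phi> \<phi> = ip \<psi> \<psi>"
proof -
  have "0 \<le> l2norm \<phi>" "0 \<le> l2norm \<psi>" by (simp_all add: l2norm_def)
  then have "l2norm \<phi> = l2norm \<psi> \<longleftrightarrow> (l2norm \<phi>)\<^sup>2 = (l2norm \<psi>)\<^sup>2" by auto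
  also have "\<dots> \<longleftrightarrow> ip \<phi> \<phi> = ip \<psi> \<psi>" by (metis l2norm_power2 of_real_eq_iff)
  finally show ?thesis .
qed

text \<open>Expanding both arguments of the inner product leaves only the diagonal of the Gram
  matrix.\<close>

lemma isometric_if_orthonormal:
  assumes "finite (supp \<phi>)" "\<And>c. c \<in> supp \<phi> \<Longrightarrow> finite (supp (F c))"
    and "\<And>c c'. c \<in> supp \<phi> \<Longrightarrow> c' \<in> supp \<phi> \<Longrightarrow> ip (F c) (F c') = (if c = c' then 1 else 0)"
  shows "l2norm (lin F \<phi>) = l2norm \<phi>"
proof -
  have "ip (lin F \<phi>) (lin F \<phi>) =
      (\<Sum>c\<in>supp \<phi>. \<Sum>c'\<in>supp \<phi>. \<phi> c * cnj (\<phi> c') * ip (F c) (F c'))"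
    using assms by (intro ip_lin_lin) auto
  also have "\<dots> = (\<Sum>c\<in>supp \<phi>. \<Sum>c'\<in>supp \<phi>. if c = c' then \<phi> c * cnj (\<phi> c') else 0)"
    by (intro sum.cong refl) (simp add: assms(3))
  also have "\<dots> = ip \<phi> \<phi>" using assms(1) by (simp add: ip_def)
  finally show ?thesis by (simp add: l2norm_eq_iff)
qed

text \<open>Polarization: norm preservation on superpositions of just two basis vectors, with
  amplitudes 1 and \<open>z\<close>, forces the cross terms to cancel for every nonzero
  \<open>z\<close>.\<close>

lemma orthonormal_if_isometric:
  assumes iso: "\<And>\<phi>. supp \<phi> \<subseteq> {c, c'} \<Longrightarrow> l2norm (lin F \<phi>) = l2norm \<phi>"
    and fin: "finite (supp (F c))" "finite (supp (F c'))"
  shows "ip (F c) (F c') = (if c = c' then 1 else 0)"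
proof (cases "c = c'")
  case True
  then show ?thesis using iso[of "ket c"] by (simp add: l2norm_eq_iff ip_ket)
next
  case False
  have unit: "ip (F c) (F c) = 1" "ip (F c') (F c') = 1"
    using iso[of "ket c"] iso[of "ket c'"] by (simp_all add: l2norm_eq_iff ip_ket)
  have pol: "cnj z * ip (F c) (F c') + z * cnj (ip (F c) (F c')) = 0" if "z \<noteq> 0" for z
  proof -
    define \<phi> where "\<phi> = (\<lambda>x. if x = c then 1 else if x = c' then z else 0)"
    have supp: "supp \<phi> = {c, c'}" using that by (auto simp: supp_def \<phi>_def)
    have val: "\<phi> c = 1" "\<phi> c' = z" using False by (auto simp: \<phi>_def)
    have "ip (lin F \<phi>) (lin F \<phi>) = ip \<phi> \<phi>"
      using iso[of \<phi>] supp by (simp add: l2norm_eq_iff)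
    moreover have "ip \<phi> \<phi> = 1 + z * cnj z"
      unfolding ip_def supp using False val by simp
    moreover have "ip (lin F \<phi>) (lin F \<phi>) =
        1 + cnj z * ip (F c) (F c') + z * ip (F c') (F c) + z * cnj z"
      using False fin val by (subst ip_lin_lin) (auto simp: supp unit)
    ultimately show ?thesis using ip_commute[OF fin] by simp
  qed
  \<comment> \<open>\<open>z = 1\<close> kills the real part of the inner product,
    \<open>z = \<i>\<close> the imaginary part.\<close>
  from pol[of 1] pol[of \<i>] have "ip (F c) (F c') = 0"
    by (simp add: complex_eq_iff)
  then show ?thesis using False by simp
qed

section \<open>Query tapes and one-step evolution\<close>

lemma query_tape_cases:
  obtains (block) s y b where "Blank \<notin> set y" "t = word_at s (y @ [Bit b])"
      "query_tape A t = word_at s (y @ [Bit (b \<noteq> (y \<in> A))])"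
  | (no_block) "query_tape A t = t"
  using query_tape_block query_tape_no_block by metis

text \<open>The answer depends only on the query word, which the query leaves in place, and adding
  the same bit twice modulo 2 cancels.\<close>

lemma query_tape_involution: "query_tape A (query_tape A t) = t"
proof (cases rule: query_tape_cases[of t A])
  case (block s y b)
  have "(b \<noteq> (y \<in> A)) \<noteq> (y \<in> A) \<longleftrightarrow> b" by blast
  then show ?thesis using block(2,3) query_tape_block[OF block(1), of A s "b \<noteq> (y \<in> A)"] by simp
qed simp

text \<open>A query can at most turn a bit into a bit; this suffices to preserve both the alphabet
  and the set of nonblank cells.\<close>

lemma query_tape_at:
  "query_tape A t z = t z \<or> (\<exists>b b'. t z = Bit b \<and> query_tape A t z = Bit b')"
proof (cases rule: query_tape_cases[of t A])
  case (block s y b)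
  then show ?thesis by (auto simp: word_at_def nth_append)
qed simp

lemma range_query_tape:
  assumes "range t \<subseteq> S" "{Bit False, Bit True} \<subseteq> S"
  shows "range (query_tape A t) \<subseteq> S"
proof -
  have "query_tape A t z \<in> S" for z
    using query_tape_at[of A t z] assms by (metis (full_types) insert_subset rangeI subsetD)
  then show ?thesis by blast
qed

lemma support_query_tape: "{z. query_tape A t z \<noteq> Blank} = {z. t z \<noteq> Blank}"
proof -
  have "query_tape A t z \<noteq> Blank \<longleftrightarrow> t z \<noteq> Blank" for z
    using query_tape_at[of A t z] by auto
  then show ?thesis by simp
qed

text \<open>Since this holds for every \<open>A\<close>, the second oracle has no influence on the
  simulation.\<close>

lemma query_tape_not_bit:
  assumes "\<forall>b. s \<noteq> Bit b"
  shows "query_tape A ((\<lambda>_. Blank)(h := s)) = (\<lambda>_. Blank)(h := s)"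
proof (rule query_tape_no_block)
  show "\<nexists>r y b. Blank \<notin> set y \<and> (\<lambda>_. Blank)(h := s) = word_at r (y @ [Bit b])"
  proof
    assume "\<exists>r y b. Blank \<notin> set y \<and> (\<lambda>_. Blank)(h := s) = word_at r (y @ [Bit b])"
    then obtain r y b where eq: "(\<lambda>_. Blank)(h := s) = word_at r (y @ [Bit b])" by blast
    have "word_at r (y @ [Bit b]) (r + int (length y)) = Bit b" by (simp add: word_at_def)
    then have "((\<lambda>_. Blank)(h := s)) (r + int (length y)) = Bit b" unfolding eq .
    then show False using assms by (auto split: if_splits)
  qed
qed

lemma finite_targets:
  assumes "oracle_qtm k m M"
  shows "finite (targets M)"
  using assms unfolding targets_def oracle_qtm_def
  by (intro finite_cartesian_product finite_listset finite_dir_lists) auto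

text \<open>The sum over triples as a sum over one variable with separate coefficient and basis
  vector, a form that allows reindexing and the use of \<open>lin_sum\<close>.\<close>

lemma step_not_pre:
  assumes "cstate c \<notin> set (pre M)"
  shows "step M As c = (\<lambda>c'. \<Sum>x\<in>targets M. (case x of (q, \<tau>, d) \<Rightarrow>
    delta M (cstate c) (scanned c) q \<tau> d) * (case x of (q, \<tau>, d) \<Rightarrow> ket (move_config c q \<tau> d)) c')"
  using assms by (simp add: step_def case_prod_unfold)

lemma step_pre:
  assumes "distinct (pre M)" "i < nqueries M" "cstate c = pre M ! i"
  shows "step M As c = ket (query_config M As i c)"
proof -
  have "(THE j. j < nqueries M \<and> pre M ! j = cstate c) = i"
    by (rule the_equality) (use assms in \<open>auto simp: nqueries_def nth_eq_iff_index_eq\<close>)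
  moreover have "cstate c \<in> set (pre M)" using assms by (simp add: nqueries_def)
  ultimately show ?thesis by (simp add: step_def)
qed

lemma query_config_in_configs:
  assumes "oracle_qtm k m M" "c \<in> configs M" "i < m"
  shows "query_config M As i c \<in> configs M"
proof -
  have "post M ! i \<in> states M" using assms unfolding oracle_qtm_def by (metis nth_mem subsetD)
  moreover have "{Bit False, Bit True} \<subseteq> alph M ! (nplain M + i)"
    using assms unfolding oracle_qtm_def nplain_def ntapes_def nqueries_def by simp
  moreover have "nplain M + i < ntapes M"
    using assms unfolding oracle_qtm_def nplain_def ntapes_def nqueries_def by simp
  moreover from calculation assms(2)
  have "range (query_tape (As ! i) (tapes c ! (nplain M + i))) \<subseteq> alph M ! (nplain M + i)"
    by (intro range_query_tape) (auto simp: configs_def)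
  ultimately show ?thesis using assms(2)
    by (simp add: configs_def query_config_def nth_list_update support_query_tape)
qed

lemma move_config_in_configs:
  assumes "c \<in> configs M" "(q, \<tau>, d) \<in> targets M"
  shows "move_config c q \<tau> d \<in> configs M"
proof -
  have "finite {z. (t(h := s)) z \<noteq> Blank}" if "finite {z. t z \<noteq> Blank}" for t :: tape and h s
    by (rule finite_subset[of _ "insert h {z. t z \<noteq> Blank}"]) (use that in auto)
  then show ?thesis using assms
    by (auto simp: configs_def move_config_def targets_def listset_iff ntapes_def image_subset_iff)
qed

lemma supp_step:
  assumes "oracle_qtm k m M"
  shows "finite (supp (step M As c))"
    and "c \<in> configs M \<Longrightarrow> supp (step M As c) \<subseteq> configs M"
proof -
  have "finite (supp (step M As c)) \<and> (c \<in> configs M \<longrightarrow> supp (step M As c) \<subseteq> configs M)"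
  proof (cases "cstate c \<in> set (pre M)")
    case True
    then obtain i where i: "i < m" "cstate c = pre M ! i"
      using assms unfolding oracle_qtm_def by (metis in_set_conv_nth)
    then have "step M As c = ket (query_config M As i c)"
      using assms by (intro step_pre) (auto simp: oracle_qtm_def nqueries_def)
    then show ?thesis using query_config_in_configs[OF assms] i by simp
  next
    case False
    let ?S = "(\<lambda>(q, \<tau>, d). move_config c q \<tau> d) ` targets M"
    have "supp (step M As c) \<subseteq> ?S"
    proof
      fix c' assume "c' \<in> supp (step M As c)"
      then have "step M As c c' \<noteq> 0" by (simp add: supp_def)
      then obtain x where "x \<in> targets M"
          "(case x of (q, \<tau>, d) \<Rightarrow> ket (move_config c q \<tau> d)) c' \<noteq> 0"
        unfolding step_not_pre[OF False] by (metis (no_types, lifting) mult_zero_right sum.neutral)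
      then show "c' \<in> ?S" by (cases x) (auto simp: ket_def image_iff split: if_splits intro!: bexI[of _ x])
    qed
    moreover have "?S \<subseteq> configs M" if "c \<in> configs M"
      using move_config_in_configs[OF that] by (auto simp del: split_paired_all)
    moreover have "finite ?S" using finite_targets[OF assms] by (rule finite_imageI)
    ultimately show ?thesis using finite_subset by (meson order_trans)
  qed
  then show "finite (supp (step M As c))"
    and "c \<in> configs M \<Longrightarrow> supp (step M As c) \<subseteq> configs M" by blast+
qed

lemma superpositions_iff:
  "\<phi> \<in> superpositions M \<longleftrightarrow> finite (supp \<phi>) \<and> supp \<phi> \<subseteq> configs M"
  by (simp add: superpositions_def supp_def)

lemma evolve_in_superpositions:
  assumes "oracle_qtm k m M" "\<phi> \<in> superpositions M"
  shows "evolve M As \<phi> \<in> superpositions M"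
  unfolding superpositions_iff evolve_eq_lin
proof
  show "finite (supp (lin (step M As) \<phi>))"
    using assms supp_step(1)[OF assms(1)] by (intro finite_supp_lin) (auto simp: superpositions_iff)
  show "supp (lin (step M As) \<phi>) \<subseteq> configs M"
    using supp_lin[of "step M As" \<phi>] supp_step(2)[OF assms(1)] assms(2)
    by (fastforce simp: superpositions_iff)
qed

lemma superpos_at_0 [simp]: "superpos_at M As x 0 = ket (initial M x)"
  by (simp add: superpos_at_def)

lemma superpos_at_Suc [simp]: "superpos_at M As x (Suc t) = evolve M As (superpos_at M As x t)"
  by (simp add: superpos_at_def)

lemma superpos_at_in_superpositions:
  assumes "oracle_qtm k m M" "initial M x \<in> configs M"
  shows "superpos_at M As x t \<in> superpositions M"
proof (induction t)
  case 0
  then show ?case using assms(2) by (simp add: superpositions_iff)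
next
  case (Suc t)
  then show ?case using evolve_in_superpositions[OF assms(1)] by simp
qed

text \<open>The zero superposition would make \<open>all_final_at\<close> vacuously true; the norm,
  which stays 1, excludes it.\<close>

lemma superpos_at_nonzero:
  assumes "oracle_qtm k m M" "well_formed M" "oracles M As" "initial M x \<in> configs M"
  shows "supp (superpos_at M As x t) \<noteq> {}"
proof -
  have "l2norm (superpos_at M As x t) = l2norm (ket (initial M x))"
  proof (induction t)
    case (Suc t)
    then show ?case using assms superpos_at_in_superpositions[OF assms(1,4)]
      by (simp add: well_formed_def)
  qed simp
  then have "ip (superpos_at M As x t) (superpos_at M As x t) = 1"
    by (simp add: l2norm_eq_iff ip_ket)
  then show ?thesis by (auto simp: ip_def)
qed

lemma initial_in_configs:
  assumes "oracle_qtm k m M" "x \<in> inputs M"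
  shows "initial M x \<in> configs M"
proof -
  have fin: "finite {z. word_at 0 w z \<noteq> Blank}" for w
    by (rule finite_subset[of _ "{0..int (length w)}"]) (auto simp: word_at_def split: if_splits)
  have ran: "range (word_at 0 w) \<subseteq> S" if "Blank \<in> S" "set w \<subseteq> S" for w S
    using that by (force simp: word_at_def)
  have "length x = k" "\<forall>i<k. set (x ! i) \<subseteq> alph M ! i"
    using assms by (auto simp: inputs_def nplain_def ntapes_def nqueries_def oracle_qtm_def)
  moreover from this assms(1) have "range (word_at 0 (x ! i)) \<subseteq> alph M ! i" if "i < k" for i
    using that by (intro ran) (auto simp: oracle_qtm_def)
  ultimately show ?thesis
    using assms(1) fin
    by (auto simp: configs_def initial_def oracle_qtm_def ntapes_def nqueries_def nth_append)
qed

text \<open>Both directions are used: orthonormality is read off from \<open>M\<close> and then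
  established for \<open>padded\<close>.\<close>

lemma well_formed_iff_orthonormal:
  assumes "oracle_qtm k m M"
  shows "well_formed M \<longleftrightarrow> (\<forall>As. oracles M As \<longrightarrow> (\<forall>c\<in>configs M. \<forall>c'\<in>configs M.
    ip (step M As c) (step M As c') = (if c = c' then 1 else 0)))" (is "_ \<longleftrightarrow> ?R")
proof
  assume wf: "well_formed M"
  show ?R
  proof (intro allI impI ballI)
    fix As c c' assume As: "oracles M As" "c \<in> configs M" "c' \<in> configs M"
    show "ip (step M As c) (step M As c') = (if c = c' then 1 else 0)"
    proof (rule orthonormal_if_isometric)
      fix \<phi> assume "supp \<phi> \<subseteq> {c, c'}"
      then have "\<phi> \<in> superpositions M"
        using As by (auto simp: superpositions_iff intro: finite_subset)
      then show "l2norm (lin (step M As) \<phi>) = l2norm \<phi>"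
        using wf As by (simp add: well_formed_def evolve_eq_lin)
    qed (rule supp_step(1)[OF assms])+
  qed
next
  assume R: ?R
  show "well_formed M"
    unfolding well_formed_def evolve_eq_lin
  proof (intro allI impI ballI)
    fix As \<phi> assume As: "oracles M As" and \<phi>: "\<phi> \<in> superpositions M"
    show "l2norm (lin (step M As) \<phi>) = l2norm \<phi>"
    proof (rule isometric_if_orthonormal)
      show "finite (supp \<phi>)" using \<phi> by (simp add: superpositions_iff)
      show "finite (supp (step M As c))" for c by (rule supp_step(1)[OF assms])
      fix c c' assume "c \<in> supp \<phi>" "c' \<in> supp \<phi>"
      then have "c \<in> configs M" "c' \<in> configs M" using \<phi> by (auto simp: superpositions_iff)
      then show "ip (step M As c) (step M As c') = (if c = c' then 1 else 0)" using R As by blast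
    qed
  qed
qed

section \<open>The padded machine\<close>

text \<open>The numbering \<open>e\<close> of the finitely many states serves twice: it encodes the
  states of the new machine as numbers and names the letter that stands for a state.\<close>

locale padding =
  fixes M :: "'q oqtm" and k :: nat and e :: "'q \<Rightarrow> nat"
  assumes machine: "oracle_qtm k 1 M" and inj_e: "inj_on e (states M)"
begin

definition qp :: 'q where "qp = pre M ! 0"

definition qa :: 'q where "qa = post M ! 0"

text \<open>
  The states of the padded machine are \<open>code q j\<close> for the \<open>j\<close>th of the seven steps that simulate a step
  of \<open>M\<close> from state \<open>q\<close>, together with the pre-query state 0 and the post-query state 1 of the second
  query tape. They take the place of \<open>code q 4\<close> and \<open>code q 5\<close> unless \<open>q\<close> is the pre-query state \<open>qp\<close>;
  the pre-query state of the first query tape is \<open>code qp 6\<close>.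
\<close>

definition code :: "'q \<Rightarrow> nat \<Rightarrow> nat" where
  "code q j = 7 * e q + j + 2"

definition base :: "nat \<Rightarrow> 'q" where
  "base n = inv_into (states M) e ((n - 2) div 7)"

definition level :: "nat \<Rightarrow> nat" where
  "level n = (n - 2) mod 7"

definition letter :: "'q \<Rightarrow> symbol" where
  "letter q = Letter (e q)"

definition plain :: "'q set" where
  "plain = states M - {qp}"

text \<open>Including the alphabet of the old query tape makes \<open>A\<close> an oracle for the
  new one too. The union may overlap: letters are told apart from other symbols nowhere except by
  \<open>hop\<close>, which is defined on all symbols.\<close>

definition aux :: "symbol set" where
  "aux = alph M ! k \<union> letter ` states M"

definition pstates :: "nat set" where
  "pstates = {0, 1} \<union> {code q j | q j. q \<in> states M \<and> j < 7 \<and> (j = 4 \<or> j = 5 \<longrightarrow> q = qp)}"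

text \<open>
  The moves that neither query nor simulate \<open>\<delta>\<close>, as a map on the state and the symbol scanned on the
  second query tape. A nonblank symbol at load time bypasses the dummy query, which fills exactly the
  gap left by unloading to a blank; foreign symbols at unload time return to the pre-query state 0.
\<close>

definition hop :: "nat \<Rightarrow> symbol \<Rightarrow> nat \<times> symbol" where
  "hop n s =
     (if n = 1 then
        if s \<in> letter ` plain then (code (inv_into plain letter s) 6, Blank) else (0, s)
      else if level n = 3 \<and> base n \<noteq> qp then
        if s = Blank then (0, letter (base n)) else (n + 3, s)
      else (n + 1, s))"

text \<open>The second query tape comes last in every tuple, so \<open>butlast\<close> is the part
  that belongs to \<open>M\<close>. Level 6 of a plain state carries the amplitudes of
  \<open>M\<close> and passes into level 0; the other branch is deterministic.\<close>

definition pdelta :: "nat \<Rightarrow> symbol list \<Rightarrow> nat \<Rightarrow> symbol list \<Rightarrow> dir list \<Rightarrow> complex" where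
  "pdelta n \<sigma> n' \<tau> d =
     (if n \<in> (\<lambda>q. code q 6) ` plain then
        if n' \<in> (\<lambda>q. code q 0) ` states M \<and> last \<tau> = last \<sigma> \<and> last d = MoveN
        then delta M (base n) (butlast \<sigma>) (base n') (butlast \<tau>) (butlast d) else 0
      else if (n', last \<tau>) = hop n (last \<sigma>) \<and> butlast \<tau> = butlast \<sigma> \<and> d = replicate (k + 2) MoveN
        then 1 else 0)"

definition padded :: "nat oqtm" where
  "padded =
     \<lparr>states = pstates,
      init = code (init M) 0,
      final = (\<lambda>q. code q 0) ` final M,
      pre = [code qp 6, 0],
      post = [code qa 0, 1],
      alph = alph M @ [aux],
      delta = pdelta,
      out = out M\<rparr>"

lemma padded_simps [simp]:
  "states padded = pstates" "init padded = code (init M) 0"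
  "final padded = (\<lambda>q. code q 0) ` final M"
  "pre padded = [code qp 6, 0]" "post padded = [code qa 0, 1]" "alph padded = alph M @ [aux]"
  "delta padded = pdelta" "out padded = out M"
  by (simp_all add: padded_def)

lemma pre_M: "pre M = [qp]" and post_M: "post M = [qa]"
  and qp: "qp \<in> states M" and qa: "qa \<in> states M"
proof -
  have "length (pre M) = 1" "length (post M) = 1" "set (pre M) \<subseteq> states M" "set (post M) \<subseteq> states M"
    using machine by (auto simp: oracle_qtm_def)
  then show "pre M = [qp]" "post M = [qa]" "qp \<in> states M" "qa \<in> states M"
    by (auto simp: qp_def qa_def length_Suc_conv)
qed

lemma alph_M: "length (alph M) = Suc k" "i \<le> k \<Longrightarrow> finite (alph M ! i)"
    "i \<le> k \<Longrightarrow> Blank \<in> alph M ! i" "Bit b \<in> alph M ! k"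
  using machine by (cases b; auto simp: oracle_qtm_def)+

lemma ntapes_M [simp]: "ntapes M = Suc k" and ntapes_padded [simp]: "ntapes padded = k + 2"
  by (simp_all add: ntapes_def alph_M)

lemma nqueries_M [simp]: "nqueries M = 1" and nqueries_padded [simp]: "nqueries padded = 2"
  by (simp_all add: nqueries_def pre_M)

lemma nplain_M [simp]: "nplain M = k" and nplain_padded [simp]: "nplain padded = k"
  by (simp_all add: nplain_def)

lemma finite_states: "finite (states M)" and init_M: "init M \<in> states M"
  and final_M: "final M \<subseteq> states M" and out_M: "out M \<le> k"
  using machine by (auto simp: oracle_qtm_def)

lemma base_code: "q \<in> states M \<Longrightarrow> j < 7 \<Longrightarrow> base (code q j) = q"
  by (simp add: base_def code_def inv_into_f_f[OF inj_e])

lemma level_code: "j < 7 \<Longrightarrow> level (code q j) = j"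
  by (simp add: level_def code_def)

lemma code_eq_iff:
  assumes "q \<in> states M" "q' \<in> states M" "j < 7" "j' < 7"
  shows "code q j = code q' j' \<longleftrightarrow> q = q' \<and> j = j'"
  using assms base_code level_code by metis

lemma code_neq [simp]: "code q j \<noteq> 0" "code q j \<noteq> Suc 0" "0 \<noteq> code q j" "Suc 0 \<noteq> code q j"
  by (simp_all add: code_def)

lemma code_in_pstates:
  "q \<in> states M \<Longrightarrow> j < 7 \<Longrightarrow> (j = 4 \<or> j = 5 \<Longrightarrow> q = qp) \<Longrightarrow> code q j \<in> pstates"
  by (auto simp: pstates_def)

lemma code_0_in_pstates: "q \<in> states M \<Longrightarrow> code q 0 \<in> pstates"
  by (rule code_in_pstates) simp_all

lemma plain_states: "q \<in> plain \<Longrightarrow> q \<in> states M" "q \<in> plain \<Longrightarrow> q \<noteq> qp"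
  by (auto simp: plain_def)

lemma qp_not_plain [simp]: "qp \<notin> plain"
  by (simp add: plain_def)

lemma inj_letter: "inj_on letter (states M)"
  using inj_e by (auto simp: inj_on_def letter_def)

lemma letter_neq [simp]: "letter q \<noteq> Blank" "letter q \<noteq> Bit b" "Blank \<noteq> letter q"
  by (simp_all add: letter_def)

section \<open>The partial map \<open>hop\<close> and its injectivity\<close>

lemma hop_unload: "q \<in> plain \<Longrightarrow> hop (Suc 0) (letter q) = (code q 6, Blank)"
proof -
  have "inj_on letter plain" using inj_letter by (rule inj_on_subset) (auto simp: plain_def)
  then show "q \<in> plain \<Longrightarrow> hop (Suc 0) (letter q) = (code q 6, Blank)" by (simp add: hop_def)
qed

lemma hop_return: "s \<notin> letter ` plain \<Longrightarrow> hop (Suc 0) s = (0, s)"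
  by (simp add: hop_def)

lemma hop_load: "q \<in> plain \<Longrightarrow> hop (code q 3) Blank = (0, letter q)"
  using plain_states[of q] by (simp add: hop_def level_code base_code)

lemma hop_skip: "q \<in> plain \<Longrightarrow> s \<noteq> Blank \<Longrightarrow> hop (code q 3) s = (code q 6, s)"
  using plain_states[of q] by (simp add: hop_def level_code base_code) (simp add: code_def)

lemma hop_delay:
  assumes "q \<in> states M" "j < 6" "j = 3 \<Longrightarrow> q = qp"
  shows "hop (code q j) s = (code q (Suc j), s)"
  using assms by (auto simp: hop_def level_code base_code) (auto simp: code_def)

lemma hop_cases:
  assumes "n \<in> pstates" "n \<noteq> 0" "n \<notin> (\<lambda>q. code q 6) ` states M"
  obtains (unload) q where "q \<in> plain" "n = Suc 0" "s = letter q" "hop n s = (code q 6, Blank)"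
  | (return) "n = Suc 0" "s \<notin> letter ` plain" "hop n s = (0, s)"
  | (load) q where "q \<in> plain" "n = code q 3" "s = Blank" "hop n s = (0, letter q)"
  | (skip) q where "q \<in> plain" "n = code q 3" "s \<noteq> Blank" "hop n s = (code q 6, s)"
  | (delay) q j where "q \<in> states M" "n = code q j" "j < 6" "j \<in> {3, 4, 5} \<Longrightarrow> q = qp"
      "hop n s = (code q (Suc j), s)"
proof (cases "n = Suc 0")
  case True
  then show ?thesis using unload return hop_unload hop_return by (cases "s \<in> letter ` plain") auto
next
  case False
  then obtain q j where q: "q \<in> states M" "n = code q j" "j < 7" "j = 4 \<or> j = 5 \<longrightarrow> q = qp"
    using assms by (auto simp: pstates_def)
  moreover have "j \<noteq> 6" using q assms by auto
  ultimately have j: "j < 6" by simp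
  show ?thesis
  proof (cases "j = 3 \<and> q \<noteq> qp")
    case True
    then have "q \<in> plain" using q by (simp add: plain_def)
    then show ?thesis using True q load skip hop_load hop_skip by (cases "s = Blank") blast+
  next
    case False
    then show ?thesis using q j hop_delay[of q j s] delay[of q j] by auto
  qed
qed

text \<open>Images in state 0 arise from \<open>return\<close>, with a symbol that is no letter of a
  plain state, or from \<open>load\<close>, with such a letter. Images in \<open>code q 6\<close>
  for plain \<open>q\<close> arise from \<open>unload\<close>, with a blank, or from
  \<open>skip\<close>, with a nonblank symbol. All others come from \<open>delay\<close>, which
  keeps the symbol; it reaches level 6 only for \<open>qp\<close>.\<close>

lemma hop_inj:
  assumes "n \<in> pstates" "n \<noteq> 0" "n \<notin> (\<lambda>q. code q 6) ` states M"
    and "n' \<in> pstates" "n' \<noteq> 0" "n' \<notin> (\<lambda>q. code q 6) ` states M"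
    and "hop n s = hop n' s'"
  shows "n = n' \<and> s = s'"
  using assms(1-3)
proof (cases rule: hop_cases[of n s])
  case unload
  from assms(4-6) show ?thesis
    by (cases rule: hop_cases[of n' s'])
      (use unload assms(7) in \<open>auto simp: code_eq_iff plain_states dest: inj_onD[OF inj_letter]\<close>)
next
  case return
  from assms(4-6) show ?thesis
    by (cases rule: hop_cases[of n' s'])
      (use return assms(7) in \<open>auto simp: code_eq_iff plain_states dest: inj_onD[OF inj_letter]\<close>)
next
  case load
  from assms(4-6) show ?thesis
    by (cases rule: hop_cases[of n' s'])
      (use load assms(7) in \<open>auto simp: code_eq_iff plain_states dest: inj_onD[OF inj_letter]\<close>)
next
  case skip
  from assms(4-6) show ?thesis
    by (cases rule: hop_cases[of n' s'])
      (use skip assms(7) in \<open>auto simp: code_eq_iff plain_states dest: inj_onD[OF inj_letter]\<close>)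
next
  case (delay q j)
  from assms(4-6) show ?thesis
    by (cases rule: hop_cases[of n' s'])
      (use delay assms(7) in \<open>auto simp: code_eq_iff plain_states dest: inj_onD[OF inj_letter]\<close>)
qed

text \<open>State 1 and level 0 are reserved for the results of dummy queries and of simulated
  steps; avoiding them keeps the images of different kinds of steps apart.\<close>

lemma hop_target:
  assumes "n \<in> pstates" "n \<noteq> 0" "n \<notin> (\<lambda>q. code q 6) ` states M"
  shows "fst (hop n s) \<in> pstates" "fst (hop n s) \<noteq> 1" "fst (hop n s) \<notin> (\<lambda>q. code q 0) ` states M"
proof -
  have "fst (hop n s) \<in> pstates \<and> fst (hop n s) \<noteq> 1 \<and> fst (hop n s) \<notin> (\<lambda>q. code q 0) ` states M"
    using assms
    by (cases rule: hop_cases[of n s])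
      (auto simp: code_eq_iff plain_states intro!: code_in_pstates, auto simp: pstates_def)
  then show "fst (hop n s) \<in> pstates" "fst (hop n s) \<noteq> 1"
    "fst (hop n s) \<notin> (\<lambda>q. code q 0) ` states M" by blast+
qed

lemma hop_symbol:
  assumes "n \<in> pstates" "n \<noteq> 0" "n \<notin> (\<lambda>q. code q 6) ` states M" "s \<in> aux"
  shows "snd (hop n s) \<in> aux"
  using assms(1-3)
  by (cases rule: hop_cases[of n s]) (use assms(4) in \<open>auto simp: aux_def alph_M plain_states\<close>)

lemma oracle_qtm_padded: "oracle_qtm k 2 padded"
proof -
  have "pstates \<subseteq> {0, 1} \<union> (\<lambda>(q, j). code q j) ` (states M \<times> {..<7})" by (auto simp: pstates_def)
  then have "finite pstates" by (rule finite_subset) (simp add: finite_states)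
  moreover have "final padded \<subseteq> pstates" using final_M by (auto intro!: code_in_pstates)
  moreover have "0 \<in> pstates" "1 \<in> pstates" by (auto simp: pstates_def)
  moreover have "finite aux" "Blank \<in> aux" by (auto simp: aux_def alph_M finite_states)
  moreover have "i < k + 2 \<Longrightarrow> i = Suc k \<or> i \<le> k" for i by auto
  moreover have "i < 2 \<Longrightarrow> i = 0 \<or> i = 1" for i :: nat by auto
  ultimately show ?thesis
    using out_M unfolding oracle_qtm_def
    by (auto simp: alph_M nth_append code_0_in_pstates code_in_pstates[of qp 6] qp qa init_M less_Suc_eq_le)
      (auto simp: aux_def alph_M)
qed

section \<open>Single steps, with the second query tape split off from the part shared with
  \<open>M\<close>\<close>

definition glue :: "nat \<Rightarrow> tape list \<Rightarrow> int list \<Rightarrow> tape \<Rightarrow> int \<Rightarrow> nat config" where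
  "glue n ts hs t h = \<lparr>cstate = n, tapes = ts @ [t], heads = hs @ [h]\<rparr>"

definition core :: "tape list \<Rightarrow> int list \<Rightarrow> bool" where
  "core ts hs \<longleftrightarrow> length ts = Suc k \<and> length hs = Suc k \<and>
     (\<forall>i\<le>k. range (ts ! i) \<subseteq> alph M ! i \<and> finite {z. (ts ! i) z \<noteq> Blank})"

lemma glue_eq_iff [simp]:
  "glue n ts hs t h = glue n' ts' hs' t' h' \<longleftrightarrow> n = n' \<and> ts = ts' \<and> hs = hs' \<and> t = t' \<and> h = h'"
  by (auto simp: glue_def)

lemma cstate_glue [simp]: "cstate (glue n ts hs t h) = n"
  by (simp add: glue_def)

lemma configs_M_iff: "c \<in> configs M \<longleftrightarrow> cstate c \<in> states M \<and> core (tapes c) (heads c)"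
  by (auto simp: configs_def core_def less_Suc_eq_le)

lemma configs_padded_cases:
  assumes "c \<in> configs padded"
  obtains n ts hs t h where "c = glue n ts hs t h" "n \<in> pstates" "core ts hs" "range t \<subseteq> aux"
proof -
  have len: "length (tapes c) = Suc (Suc k)" "length (heads c) = Suc (Suc k)"
    using assms by (auto simp: configs_def)
  then obtain ts t hs h where th: "tapes c = ts @ [t]" "heads c = hs @ [h]"
    by (metis length_Suc_conv_rev)
  have tape: "range ((ts @ [t]) ! i) \<subseteq> (alph M @ [aux]) ! i \<and> finite {z. ((ts @ [t]) ! i) z \<noteq> Blank}"
    if "i < Suc (Suc k)" for i
    using assms that by (simp add: configs_def th)
  have "range t \<subseteq> aux" using tape[of "Suc k"] len by (simp add: th nth_append alph_M)
  moreover have "range (ts ! i) \<subseteq> alph M ! i \<and> finite {z. (ts ! i) z \<noteq> Blank}" if "i \<le> k" for i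
    using tape[of i] that len by (simp add: th nth_append alph_M)
  then have "core ts hs" using len by (simp add: core_def th)
  moreover have "c = glue (cstate c) ts hs t h" "cstate c \<in> pstates"
    using assms by (auto simp: glue_def th[symmetric] configs_def)
  ultimately show ?thesis using that by blast
qed

lemma scanned_glue:
  assumes "length ts = length hs"
  shows "scanned (glue n ts hs t h) = map2 (\<lambda>t h. t h) ts hs @ [t h]"
  using assms by (simp add: scanned_def glue_def)

text \<open>The states \<open>q\<close> and \<open>q'\<close> are arbitrary: they only complete the
  core to a configuration of \<open>M\<close>, from whose move the tapes and heads are
  extracted.\<close>

lemma move_config_glue:
  assumes "length ts = Suc k" "length hs = Suc k" "length \<tau> = Suc k" "length d = Suc k"
  shows "move_config (glue n ts hs t h) n' (\<tau> @ [s]) (d @ [MoveN]) =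
    glue n' (tapes (move_config \<lparr>cstate = q, tapes = ts, heads = hs\<rparr> q' \<tau> d))
      (heads (move_config \<lparr>cstate = q, tapes = ts, heads = hs\<rparr> q' \<tau> d)) (t(h := s)) h"
  using assms by (auto simp: move_config_def glue_def nth_append intro!: nth_equalityI)

lemma move_config_stay:
  assumes "length ts = Suc k" "length hs = Suc k"
  shows "move_config (glue n ts hs t h) n' (map2 (\<lambda>t h. t h) ts hs @ [s]) (replicate (k + 2) MoveN) =
    glue n' ts hs (t(h := s)) h"
proof -
  have stay: "shift (replicate (Suc (Suc k)) MoveN ! i) = 0" if "i < Suc (Suc k)" for i
    using that by (simp del: replicate_Suc)
  show ?thesis
    using assms
    by (auto simp: move_config_def glue_def nth_append less_Suc_eq stay simp del: replicate_Suc
        intro!: nth_equalityI)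
qed

lemma step_dummy_query:
  assumes "length ts = Suc k"
  shows "step padded As (glue 0 ts hs t h) = ket (glue 1 ts hs (query_tape (As ! 1) t) h)"
proof -
  have "step padded As (glue 0 ts hs t h) = ket (query_config padded As 1 (glue 0 ts hs t h))"
    by (rule step_pre) simp_all
  then show ?thesis
    using assms by (simp add: query_config_def glue_def nth_append list_update_append)
qed

lemma scanned_in_listset:
  assumes "core ts hs"
  shows "map2 (\<lambda>t h. t h) ts hs \<in> listset (alph M)"
  using assms by (auto simp: listset_iff core_def alph_M less_Suc_eq_le image_subset_iff)

lemma step_hop:
  assumes n: "n \<in> pstates" "n \<noteq> 0" "n \<notin> (\<lambda>q. code q 6) ` states M"
    and c: "core ts hs" "range t \<subseteq> aux"
  shows "step padded As (glue n ts hs t h) =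
    ket (glue (fst (hop n (t h))) ts hs (t(h := snd (hop n (t h)))) h)"
proof -
  define \<sigma> where "\<sigma> = map2 (\<lambda>t h. t h) ts hs"
  define x where "x = (fst (hop n (t h)), \<sigma> @ [snd (hop n (t h))], replicate (k + 2) MoveN)"
  have len: "length ts = Suc k" "length hs = Suc k" using c by (auto simp: core_def)
  have "\<sigma> \<in> listset (alph M)" unfolding \<sigma>_def using c(1) by (rule scanned_in_listset)
  moreover have "snd (hop n (t h)) \<in> aux" using n c(2) by (intro hop_symbol) auto
  ultimately have x: "x \<in> targets padded"
    using hop_target(1)[OF n] by (auto simp: x_def targets_def listset_iff nth_append less_Suc_eq)
  have npre: "cstate (glue n ts hs t h) \<notin> set (pre padded)" using n qp by auto
  have nplain: "n \<notin> (\<lambda>q. code q 6) ` plain" using n by (auto simp: plain_def)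
  \<comment> \<open>On legal targets the amplitudes are the indicator of the single tuple
    \<open>x\<close>, so the sum collapses.\<close>
  have \<delta>: "(case y of (q, \<tau>, d) \<Rightarrow> pdelta n (\<sigma> @ [t h]) q \<tau> d) = (if y = x then 1 else 0)"
    if y: "y \<in> targets padded" for y
  proof -
    obtain n' \<tau> d where y': "y = (n', \<tau>, d)" by (cases y)
    have "length \<tau> = Suc (Suc k)" using y by (auto simp: y' targets_def listset_iff alph_M)
    then obtain \<tau>' s where "\<tau> = \<tau>' @ [s]" by (metis length_Suc_conv_rev)
    then show ?thesis using nplain by (auto simp: y' pdelta_def x_def prod_eq_iff)
  qed
  have "step padded As (glue n ts hs t h) c' =
      ket (glue (fst (hop n (t h))) ts hs (t(h := snd (hop n (t h)))) h) c'" for c'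
  proof -
    have "step padded As (glue n ts hs t h) c' = (\<Sum>y\<in>targets padded. if y = x then
        (case y of (q, \<tau>, d) \<Rightarrow> ket (move_config (glue n ts hs t h) q \<tau> d)) c' else 0)"
      unfolding step_not_pre[OF npre] using len
      by (intro sum.cong refl) (simp add: scanned_glue \<sigma>_def[symmetric] \<delta>)
    also have "\<dots> = (case x of (q, \<tau>, d) \<Rightarrow> ket (move_config (glue n ts hs t h) q \<tau> d)) c'"
      using x by (simp add: finite_targets[OF oracle_qtm_padded])
    finally show ?thesis
      by (simp only: x_def prod.case \<sigma>_def move_config_stay[OF len])
  qed
  then show ?thesis by blast
qed

text \<open>Embeds configurations of \<open>M\<close> at level 0 next to a fixed content of the
  second query tape. Content and head are parameters because well-formedness has to be shown for all
  of them.\<close>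

definition attach :: "tape \<Rightarrow> int \<Rightarrow> 'q config \<Rightarrow> nat config" where
  "attach t h c = glue (code (cstate c) 0) (tapes c) (heads c) t h"

text \<open>For \<open>qp\<close> both machines make the same query, with the first oracle.
  Otherwise the embedding \<open>F\<close> matches the targets of \<open>M\<close> with those
  targets of \<open>padded\<close> that can have nonzero amplitude, so both sums have the same
  terms.\<close>

lemma step_simulate:
  assumes q: "q \<in> states M" and c: "core ts hs" "range t \<subseteq> aux"
  shows "step padded As (glue (code q 6) ts hs t h) =
    push (attach t h) (step M [As ! 0] \<lparr>cstate = q, tapes = ts, heads = hs\<rparr>)"
proof -
  define c0 where "c0 = \<lparr>cstate = q, tapes = ts, heads = hs\<rparr>"
  have len: "length ts = Suc k" "length hs = Suc k" using c by (auto simp: core_def)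
  show ?thesis
  proof (cases "q = qp")
    case True
    have "step padded As (glue (code q 6) ts hs t h) =
        ket (query_config padded As 0 (glue (code q 6) ts hs t h))"
      using True by (intro step_pre) simp_all
    also have "query_config padded As 0 (glue (code q 6) ts hs t h) =
        attach t h (query_config M [As ! 0] 0 c0)"
      using len
      by (simp add: query_config_def attach_def glue_def c0_def post_M nth_append list_update_append)
    finally have "step padded As (glue (code q 6) ts hs t h) =
        ket (attach t h (query_config M [As ! 0] 0 c0))" .
    moreover have "step M [As ! 0] c0 = ket (query_config M [As ! 0] 0 c0)"
      using True by (intro step_pre) (simp_all add: pre_M c0_def)
    ultimately show ?thesis by (simp add: c0_def)
  next
    case False
    define \<sigma> where "\<sigma> = map2 (\<lambda>t h. t h) ts hs"
    define F where "F = (\<lambda>(q, \<tau>, d). (code q 0, \<tau> @ [t h], d @ [MoveN]))"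
    have \<sigma>: "scanned c0 = \<sigma>" by (simp add: scanned_def c0_def \<sigma>_def)
    have npre: "cstate (glue (code q 6) ts hs t h) \<notin> set (pre padded)"
      using q qp False by (simp add: code_eq_iff)
    have npre0: "cstate c0 \<notin> set (pre M)" using False by (simp add: pre_M c0_def)
    have plain: "code q 6 \<in> (\<lambda>q. code q 6) ` plain" using False q by (simp add: plain_def)
    have inj: "inj_on F (targets M)"
      unfolding inj_on_def F_def by (auto simp add: targets_def code_eq_iff)
    have sub: "F ` targets M \<subseteq> targets padded"
    proof
      fix y assume "y \<in> F ` targets M"
      then obtain q' \<tau> d where "y = F (q', \<tau>, d)" "(q', \<tau>, d) \<in> targets M" by auto
      then show "y \<in> targets padded"
        using c(2) code_0_in_pstates[of q']
        by (auto simp: F_def targets_def listset_iff nth_append less_Suc_eq alph_M)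
    qed
    \<comment> \<open>A nonzero amplitude forces level 0, an unchanged last symbol and an unmoved
      last head; such a target already lies in the image of \<open>F\<close>.\<close>
    have zero: "(case y of (n', \<tau>, d) \<Rightarrow> pdelta (code q 6) (\<sigma> @ [t h]) n' \<tau> d) = 0"
      if y: "y \<in> targets padded - F ` targets M" for y
    proof (rule ccontr)
      assume nz: "(case y of (n', \<tau>, d) \<Rightarrow> pdelta (code q 6) (\<sigma> @ [t h]) n' \<tau> d) \<noteq> 0"
      obtain n' \<tau> d where y': "y = (n', \<tau>, d)" by (cases y)
      have len': "length \<tau> = Suc (Suc k)" "length d = Suc (Suc k)"
        and al: "\<forall>i<Suc (Suc k). \<tau> ! i \<in> (alph M @ [aux]) ! i"
        using y by (auto simp: y' targets_def listset_iff alph_M)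
      obtain \<tau>' s d' m where \<tau>d: "\<tau> = \<tau>' @ [s]" "d = d' @ [m]"
        using len' by (metis length_Suc_conv_rev)
      obtain q' where q': "q' \<in> states M" "n' = code q' 0" "s = t h" "m = MoveN"
        using nz plain by (auto simp: y' \<tau>d pdelta_def split: if_splits)
      have "\<tau>' ! i \<in> alph M ! i" if "i < Suc k" for i
        using al[rule_format, of i] that len' by (simp add: \<tau>d nth_append alph_M)
      then have "(q', \<tau>', d') \<in> targets M"
        using q' len' by (simp add: targets_def listset_iff alph_M \<tau>d)
      then have "F (q', \<tau>', d') \<in> F ` targets M" by (rule imageI)
      then show False using y by (simp add: F_def y' \<tau>d q')
    qed
    have "step padded As (glue (code q 6) ts hs t h) c' = push (attach t h) (step M [As ! 0] c0) c'"
      for c'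
    proof -
      have "step padded As (glue (code q 6) ts hs t h) c' = (\<Sum>y\<in>F ` targets M.
          (case y of (n', \<tau>, d) \<Rightarrow> pdelta (code q 6) (\<sigma> @ [t h]) n' \<tau> d) *
          (case y of (n', \<tau>, d) \<Rightarrow> ket (move_config (glue (code q 6) ts hs t h) n' \<tau> d)) c')"
        unfolding step_not_pre[OF npre] using len
        by (intro sum.mono_neutral_cong_right finite_targets[OF oracle_qtm_padded] sub)
          (auto simp: scanned_glue \<sigma>_def[symmetric] zero)
      also have "\<dots> = (\<Sum>x\<in>targets M.
          (case x of (q', \<tau>, d) \<Rightarrow> delta M (cstate c0) (scanned c0) q' \<tau> d) *
          (case x of (q', \<tau>, d) \<Rightarrow> ket (attach t h (move_config c0 q' \<tau> d))) c')"
        unfolding sum.reindex[OF inj] comp_def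
      proof (intro sum.cong refl)
        fix x assume x: "x \<in> targets M"
        obtain q' \<tau> d where x': "x = (q', \<tau>, d)" by (cases x)
        have x'': "q' \<in> states M" "length \<tau> = Suc k" "length d = Suc k"
          using x by (auto simp: x' targets_def listset_iff alph_M)
        have "pdelta (code q 6) (\<sigma> @ [t h]) (code q' 0) (\<tau> @ [t h]) (d @ [MoveN]) =
            delta M (cstate c0) (scanned c0) q' \<tau> d"
          using plain x'' q by (simp add: pdelta_def base_code \<sigma>[symmetric] c0_def)
        moreover have "move_config (glue (code q 6) ts hs t h) (code q' 0) (\<tau> @ [t h]) (d @ [MoveN]) =
            attach t h (move_config c0 q' \<tau> d)"
          unfolding move_config_glue[OF len x''(2,3), where q = q and q' = q'] attach_def c0_def
          by (simp add: move_config_def)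
        ultimately show "(case F x of (n', \<tau>, d) \<Rightarrow> pdelta (code q 6) (\<sigma> @ [t h]) n' \<tau> d) *
          (case F x of (n', \<tau>, d) \<Rightarrow> ket (move_config (glue (code q 6) ts hs t h) n' \<tau> d)) c' =
          (case x of (q', \<tau>, d) \<Rightarrow> delta M (cstate c0) (scanned c0) q' \<tau> d) *
          (case x of (q', \<tau>, d) \<Rightarrow> ket (attach t h (move_config c0 q' \<tau> d))) c'"
          by (simp add: x' F_def)
      qed
      also have "\<dots> = push (attach t h) (step M [As ! 0] c0) c'"
        unfolding step_not_pre[OF npre0] push_def
        by (subst lin_sum) (auto simp: finite_targets[OF machine] intro!: sum.cong)
      finally show ?thesis .
    qed
    then show ?thesis unfolding c0_def by blast
  qed
qed

section \<open>Well-formedness and simulation\<close>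

text \<open>Below level 6 every step is deterministic; the dummy query and \<open>hop\<close> are
  merged here into one map on basis configurations.\<close>

definition advance :: "symbol list set list \<Rightarrow> nat \<Rightarrow> tape list \<Rightarrow> int list \<Rightarrow> tape \<Rightarrow> int \<Rightarrow> nat config" where
  "advance As n ts hs t h =
     (if n = 0 then glue 1 ts hs (query_tape (As ! 1) t) h
      else glue (fst (hop n (t h))) ts hs (t(h := snd (hop n (t h)))) h)"

lemma step_advance:
  assumes "n \<in> pstates" "n \<notin> (\<lambda>q. code q 6) ` states M" "core ts hs" "range t \<subseteq> aux"
  shows "step padded As (glue n ts hs t h) = ket (advance As n ts hs t h)"
  using assms step_dummy_query step_hop by (simp add: advance_def core_def)

text \<open>Only the dummy query enters state 1, and it is an involution on tapes. For two hops, the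
  new state and the written symbol determine the old ones by \<open>hop_inj\<close>, and all other
  cells are untouched.\<close>

lemma advance_inj:
  assumes "n \<in> pstates" "n \<notin> (\<lambda>q. code q 6) ` states M"
    and "n' \<in> pstates" "n' \<notin> (\<lambda>q. code q 6) ` states M"
    and eq: "advance As n ts hs t h = advance As n' ts' hs' t' h'"
  shows "glue n ts hs t h = glue n' ts' hs' t' h'"
proof -
  consider "n = 0" "n' = 0" | "n = 0" "n' \<noteq> 0" | "n \<noteq> 0" "n' = 0" | "n \<noteq> 0" "n' \<noteq> 0" by blast
  then show ?thesis
  proof cases
    case 1
    then show ?thesis using eq by (auto simp: advance_def) (metis query_tape_involution)
  next
    case 2
    then show ?thesis using eq hop_target(2)[OF assms(3) _ assms(4), of "t' h'"]
      by (auto simp: advance_def)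
  next
    case 3
    then show ?thesis using eq hop_target(2)[OF assms(1) _ assms(2), of "t h"]
      by (auto simp: advance_def)
  next
    case 4
    then have e: "fst (hop n (t h)) = fst (hop n' (t' h'))" "ts = ts'" "hs = hs'" "h = h'"
        "t(h := snd (hop n (t h))) = t'(h := snd (hop n' (t' h')))"
      using eq by (auto simp: advance_def)
    have "hop n (t h) = hop n' (t' h')"
      using e(1) fun_cong[OF e(5), of h] by (simp add: prod_eq_iff)
    then have nt: "n = n'" "t h = t' h'" using hop_inj assms(1-4) 4 by blast+
    have "t z = t' z" for z
      using fun_cong[OF e(5), of z] nt(2) e(4) by (cases "z = h") auto
    then show ?thesis using nt(1) e by auto
  qed
qed

lemma cstate_advance:
  assumes "n \<in> pstates" "n \<notin> (\<lambda>q. code q 6) ` states M"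
  shows "cstate (advance As n ts hs t h) \<notin> (\<lambda>q. code q 0) ` states M"
  using assms hop_target(3)[of n] by (auto simp: advance_def)

lemma attach_inj: "inj_on (attach t h) (configs M)"
  by (rule inj_onI) (auto simp: attach_def configs_M_iff code_eq_iff)

lemma supp_attach:
  assumes "c \<in> configs M"
  shows "supp (push (attach t h) (step M As c)) \<subseteq> attach t h ` configs M"
  using supp_push_subset supp_step(2)[OF machine assms] by blast

text \<open>Two simulated steps with the same second query tape and head inherit their inner product
  from \<open>M\<close>; if these differ, the supports are disjoint. A simulated and a deterministic
  step differ in the target state, and two deterministic steps are settled by injectivity.\<close>

lemma well_formed_padded:
  assumes "well_formed M"
  shows "well_formed padded"
  unfolding well_formed_iff_orthonormal[OF oracle_qtm_padded]
proof (intro allI impI ballI)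
  fix As c c' assume As: "oracles padded As" and c: "c \<in> configs padded" and c': "c' \<in> configs padded"
  let ?L = "(\<lambda>q. code q 6) ` states M"
  have "As ! 0 \<subseteq> lists (alph M ! k)"
    using As by (auto simp: oracles_def nth_append alph_M less_2_cases_iff)
  then have "oracles M [As ! 0]" by (simp add: oracles_def)
  then have orth: "ip (step M [As ! 0] b) (step M [As ! 0] b') = (if b = b' then 1 else 0)"
    if "b \<in> configs M" "b' \<in> configs M" for b b'
    using assms that well_formed_iff_orthonormal[OF machine] by blast
  obtain n ts hs t h where g: "c = glue n ts hs t h" "n \<in> pstates" "core ts hs" "range t \<subseteq> aux"
    using c by (rule configs_padded_cases)
  obtain n' ts' hs' t' h' where
    g': "c' = glue n' ts' hs' t' h'" "n' \<in> pstates" "core ts' hs'" "range t' \<subseteq> aux"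
    using c' by (rule configs_padded_cases)
  have sim: "\<exists>b \<in> configs M. b = \<lparr>cstate = q, tapes = ts, heads = hs\<rparr> \<and>
      step padded As (glue n ts hs t h) = push (attach t h) (step M [As ! 0] b)"
    if "q \<in> states M" "n = code q 6" "core ts hs" "range t \<subseteq> aux" for q n ts hs t h
    using that step_simulate[of q ts hs t As h] by (auto simp: configs_M_iff)
  have mixed: "supp (ket (advance As n ts hs t h)) \<inter> supp (push (attach t' h') (step M [As ! 0] b)) = {}"
    if "n \<in> pstates" "n \<notin> ?L" "b \<in> configs M" for n ts hs t h t' h' b
    using cstate_advance[OF that(1,2), of As ts hs t h] supp_attach[OF that(3), of t' h' "[As ! 0]"]
    by (auto simp: attach_def configs_M_iff)
  consider "n \<in> ?L" "n' \<in> ?L" | "n \<in> ?L" "n' \<notin> ?L" | "n \<notin> ?L" "n' \<in> ?L" | "n \<notin> ?L" "n' \<notin> ?L"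
    by blast
  then show "ip (step padded As c) (step padded As c') = (if c = c' then 1 else 0)"
  proof cases
    case 1
    then obtain q q' where q: "q \<in> states M" "n = code q 6" "q' \<in> states M" "n' = code q' 6" by blast
    define b where "b = \<lparr>cstate = q, tapes = ts, heads = hs\<rparr>"
    define b' where "b' = \<lparr>cstate = q', tapes = ts', heads = hs'\<rparr>"
    have b: "b \<in> configs M" "step padded As c = push (attach t h) (step M [As ! 0] b)"
      using sim[of q n ts hs t h] q g by (auto simp: b_def)
    have b': "b' \<in> configs M" "step padded As c' = push (attach t' h') (step M [As ! 0] b')"
      using sim[of q' n' ts' hs' t' h'] q g' by (auto simp: b'_def)
    show ?thesis
    proof (cases "t = t' \<and> h = h'")
      case True
      have "ip (step padded As c) (step padded As c') = ip (step M [As ! 0] b) (step M [As ! 0] b')"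
        unfolding b b' using True supp_step(2)[OF machine b(1)] supp_step(2)[OF machine b'(1)]
        by (auto intro!: ip_push inj_on_subset[OF attach_inj] supp_step(1)[OF machine])
      moreover have "b = b' \<longleftrightarrow> c = c'"
        using True q by (auto simp: g g' b_def b'_def code_eq_iff)
      ultimately show ?thesis using orth b b' by simp
    next
      case False
      then have "range (attach t h) \<inter> range (attach t' h') = {}" by (auto simp: attach_def)
      then have "supp (step padded As c) \<inter> supp (step padded As c') = {}"
        unfolding b b'
        using supp_push_subset[of "attach t h" "step M [As ! 0] b"]
          supp_push_subset[of "attach t' h'" "step M [As ! 0] b'"] by blast
      then show ?thesis using False by (auto simp: g g' ip_disjoint)
    qed
  next
    case 2
    then obtain b where "b \<in> configs M" "step padded As c = push (attach t h) (step M [As ! 0] b)"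
      using sim g by blast
    then show ?thesis using 2 g g' mixed by (auto simp: step_advance intro!: ip_disjoint)
  next
    case 3
    then obtain b where "b \<in> configs M" "step padded As c' = push (attach t' h') (step M [As ! 0] b)"
      using sim g' by blast
    then show ?thesis using 3 g g' mixed by (auto simp: step_advance intro!: ip_disjoint)
  next
    case 4
    have "advance As n ts hs t h = advance As n' ts' hs' t' h' \<longleftrightarrow> c = c'"
      using advance_inj[OF g(2) 4(1) g'(2) 4(2)] g(1) g'(1) by (metis glue_eq_iff)
    then show ?thesis using g g' 4 by (simp add: step_advance ip_ket)
  qed
qed

text \<open>The configuration that is reached \<open>j\<close> steps after the start of the block
  simulating a step from \<open>c\<close>. The subtraction \<open>j - 4\<close> yields the states 0
  and 1 around the dummy query, while the letter in cell 0 remembers the state of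
  \<open>M\<close>.\<close>

definition traj :: "nat \<Rightarrow> 'q config \<Rightarrow> nat config" where
  "traj j c =
     (if cstate c = qp \<or> j \<notin> {4, 5} then glue (code (cstate c) j) (tapes c) (heads c) (\<lambda>_. Blank) 0
      else glue (j - 4) (tapes c) (heads c) ((\<lambda>_. Blank)(0 := letter (cstate c))) 0)"

lemma traj_0: "traj 0 = attach (\<lambda>_. Blank) 0"
  by (simp add: fun_eq_iff traj_def attach_def)

lemma step_traj:
  assumes c: "c \<in> configs M" and j: "j < 6"
  shows "step padded As (traj j c) = ket (traj (Suc j) c)"
proof -
  define q where "q = cstate c"
  have q: "q \<in> states M" "core (tapes c) (heads c)" using c by (auto simp: configs_M_iff q_def)
  have blank: "range (\<lambda>_. Blank) \<subseteq> aux" and letter: "range ((\<lambda>_. Blank)(0 := letter q)) \<subseteq> aux"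
    using q by (auto simp: aux_def alph_M)
  show ?thesis
  proof (cases "q = qp \<or> j < 3")
    case True
    have "code q j \<in> pstates" "code q j \<notin> (\<lambda>q. code q 6) ` states M"
      using True j q by (auto simp: code_eq_iff intro!: code_in_pstates)
    moreover have "hop (code q j) Blank = (code q (Suc j), Blank)"
      using True j q by (intro hop_delay) auto
    ultimately have "step padded As (glue (code q j) (tapes c) (heads c) (\<lambda>_. Blank) 0) =
        ket (glue (code q (Suc j)) (tapes c) (heads c) (\<lambda>_. Blank) 0)"
      using q(2) blank step_hop[of "code q j" "tapes c" "heads c" "\<lambda>_. Blank" As 0]
      by (simp add: fun_upd_idem)
    moreover have "traj j c = glue (code q j) (tapes c) (heads c) (\<lambda>_. Blank) 0"
      "traj (Suc j) c = glue (code q (Suc j)) (tapes c) (heads c) (\<lambda>_. Blank) 0"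
      using True by (auto simp: traj_def q_def[symmetric])
    ultimately show ?thesis by simp
  next
    case False
    then have plain: "q \<in> plain" using q by (simp add: plain_def)
    consider "j = 3" | "j = 4" | "j = 5" using False j by linarith
    then show ?thesis
    proof cases
      case 1
      have "code q 3 \<in> pstates" "code q 3 \<notin> (\<lambda>q. code q 6) ` states M"
        using q by (auto simp: code_eq_iff intro!: code_in_pstates)
      then show ?thesis
        using 1 False q blank hop_load[OF plain] by (simp add: traj_def q_def[symmetric] step_hop)
    next
      case 2
      have "length (tapes c) = Suc k" using q by (simp add: core_def)
      then show ?thesis
        using 2 False
        by (simp add: traj_def q_def[symmetric] step_dummy_query query_tape_not_bit)
    next
      case 3
      have "Suc 0 \<in> pstates" by (simp add: pstates_def)
      moreover have "Suc 0 \<notin> (\<lambda>q. code q 6) ` states M" by auto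
      ultimately have "step padded As
          (glue (Suc 0) (tapes c) (heads c) ((\<lambda>_. Blank)(0 := letter q)) 0) =
          ket (glue (code q 6) (tapes c) (heads c) (\<lambda>_. Blank) 0)"
        using q(2) letter hop_unload[OF plain]
          step_hop[of "Suc 0" "tapes c" "heads c" "(\<lambda>_. Blank)(0 := letter q)" As 0]
        by (simp add: fun_upd_idem)
      then show ?thesis using 3 False by (simp add: traj_def q_def[symmetric])
    qed
  qed
qed

text \<open>The only step of a block in which the amplitudes of \<open>M\<close> and the first
  oracle enter; it leads to the start of the next block.\<close>

lemma step_traj_6:
  assumes "c \<in> configs M"
  shows "step padded As (traj 6 c) = push (traj 0) (step M [As ! 0] c)"
proof -
  have "range (\<lambda>_. Blank) \<subseteq> aux" by (auto simp: aux_def alph_M)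
  then have "step padded As (glue (code (cstate c) 6) (tapes c) (heads c) (\<lambda>_. Blank) 0) =
      push (attach (\<lambda>_. Blank) 0)
        (step M [As ! 0] \<lparr>cstate = cstate c, tapes = tapes c, heads = heads c\<rparr>)"
    using assms by (intro step_simulate) (simp_all add: configs_M_iff)
  also have "\<lparr>cstate = cstate c, tapes = tapes c, heads = heads c\<rparr> = c" by simp
  finally show ?thesis by (simp add: traj_def[of 6] traj_0)
qed

lemma traj_0_inj: "inj_on (traj 0) (configs M)"
  unfolding traj_0 by (rule attach_inj)

lemma traj_initial:
  assumes "x \<in> inputs M"
  shows "initial padded x = traj 0 (initial M x)"
  by (simp add: traj_def initial_def glue_def numeral_2_eq_2 replicate_append_same)

text \<open>Inside a block the superposition of \<open>M\<close> stands still while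
  \<open>traj\<close> moves on; from level 6 to the next block it makes one step. As
  \<open>(r, 6)\<close> precedes \<open>(Suc r, 0)\<close>, the induction runs over the total
  time.\<close>

lemma superpos_at_padded:
  assumes x: "x \<in> inputs M" and "j < 7"
  shows "superpos_at padded As x (7 * t + j) = push (traj j) (superpos_at M [As ! 0] x t)"
  using \<open>j < 7\<close>
proof (induction "7 * t + j" arbitrary: t j rule: less_induct)
  case less
  let ?\<phi> = "superpos_at M [As ! 0] x"
  have \<phi>: "finite (supp (?\<phi> t))" "supp (?\<phi> t) \<subseteq> configs M" for t
    using superpos_at_in_superpositions[OF machine initial_in_configs[OF machine x], of "[As ! 0]" t]
    by (simp_all add: superpositions_iff)
  have ev: "evolve padded As (push f (?\<phi> t)) = lin (\<lambda>c. step padded As (f c)) (?\<phi> t)" for f t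
    unfolding evolve_eq_lin push_def using \<phi>(1) by (subst lin_lin) simp_all
  consider "t = 0" "j = 0" | i where "j = Suc i" | r where "t = Suc r" "j = 0"
    by (metis not0_implies_Suc)
  then show ?case
  proof cases
    case 1
    then show ?thesis by (simp add: traj_initial[OF x])
  next
    case 2
    have "superpos_at padded As x (7 * t + i) = push (traj i) (?\<phi> t)"
      using 2 less.prems by (intro less.hyps) simp_all
    then have "superpos_at padded As x (7 * t + j) = lin (\<lambda>c. step padded As (traj i c)) (?\<phi> t)"
      using 2 by (simp add: ev)
    also have "\<dots> = push (traj j) (?\<phi> t)"
      unfolding push_def using \<phi>(2)[of t] 2 less.prems by (intro lin_cong) (auto simp: step_traj)
    finally show ?thesis .
  next
    case 3
    have "superpos_at padded As x (7 * r + 6) = push (traj 6) (?\<phi> r)"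
      using 3 by (intro less.hyps) simp_all
    moreover have "7 * t + j = Suc (7 * r + 6)" using 3 by simp
    ultimately have "superpos_at padded As x (7 * t + j) = lin (\<lambda>c. step padded As (traj 6 c)) (?\<phi> r)"
      by (simp only: superpos_at_Suc ev)
    also have "\<dots> = lin (\<lambda>c. push (traj 0) (step M [As ! 0] c)) (?\<phi> r)"
      using \<phi>(2)[of r] by (intro lin_cong) (auto simp: step_traj_6)
    also have "\<dots> = push (traj j) (?\<phi> t)"
      using 3 \<phi>(1) supp_step(1)[OF machine] by (simp add: push_def evolve_eq_lin lin_lin)
    finally show ?thesis .
  qed
qed

section \<open>Running time and acceptance probability\<close>

lemma supp_superpos_at_padded:
  assumes "x \<in> inputs M"
  shows "supp (superpos_at padded As x (7 * t)) = traj 0 ` supp (superpos_at M [As ! 0] x t)"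
proof -
  have "superpos_at M [As ! 0] x t \<in> superpositions M"
    using assms machine by (intro superpos_at_in_superpositions initial_in_configs)
  then show ?thesis
    using superpos_at_padded[OF assms, of 0 As t] inj_on_subset[OF traj_0_inj]
    by (simp add: supp_push superpositions_iff)
qed

lemma all_final_at_padded:
  assumes "x \<in> inputs M"
  shows "all_final_at padded As x (7 * t) \<longleftrightarrow> all_final_at M [As ! 0] x t"
proof -
  have \<phi>: "supp (superpos_at M [As ! 0] x t) \<subseteq> configs M"
    using superpos_at_in_superpositions[OF machine initial_in_configs[OF machine assms]]
    by (simp add: superpositions_iff)
  have af: "all_final_at N Bs y s \<longleftrightarrow> (\<forall>c\<in>supp (superpos_at N Bs y s). cstate c \<in> final N)"
    for N :: "'r oqtm" and Bs y s by (auto simp: all_final_at_def supp_def)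
  have "cstate (traj 0 c) \<in> final padded \<longleftrightarrow> cstate c \<in> final M"
    if "c \<in> supp (superpos_at M [As ! 0] x t)" for c
    using that \<phi> final_M by (force simp: traj_def configs_M_iff code_eq_iff)
  then show ?thesis unfolding af supp_superpos_at_padded[OF assms] by blast
qed

lemma inputs_padded:
  assumes "x \<in> inputs M"
  shows "x \<in> inputs padded"
  using assms by (auto simp: inputs_def nth_append alph_M)

text \<open>At a time with remainder \<open>j\<close> from 1 to 6, every configuration in the
  support is some \<open>traj j c\<close>, whose state is 0, 1 or at level \<open>j\<close>, whereas
  final states are at level 0. The support is nonempty because \<open>padded\<close> is
  well-formed.\<close>

lemma all_final_at_padded_dvd:
  assumes "well_formed M" "oracles padded As" "x \<in> inputs M" "all_final_at padded As x s"
  shows "7 dvd s"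
proof (rule ccontr)
  assume "\<not> 7 dvd s"
  define t j where "t = s div 7" and "j = s mod 7"
  have j: "j < 7" "j \<noteq> 0" and s: "s = 7 * t + j"
    using \<open>\<not> 7 dvd s\<close> by (auto simp: t_def j_def dvd_eq_mod_eq_0)
  have "supp (superpos_at padded As x s) \<noteq> {}"
    using assms oracle_qtm_padded
    by (intro superpos_at_nonzero well_formed_padded initial_in_configs inputs_padded)
  then obtain c where "c \<in> supp (superpos_at M [As ! 0] x t)" and
    c: "superpos_at padded As x s (traj j c) \<noteq> 0"
    using supp_push_subset[of "traj j"] superpos_at_padded[OF assms(3) j(1)]
    by (fastforce simp: supp_def s)
  moreover have "superpos_at M [As ! 0] x t \<in> superpositions M"
    using assms(3) machine by (intro superpos_at_in_superpositions initial_in_configs)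
  ultimately have "cstate c \<in> states M"
    by (auto simp: superpositions_iff configs_M_iff)
  then have "cstate (traj j c) \<notin> final padded"
    using j final_M by (auto simp: traj_def code_eq_iff)
  then show False using assms(4) c by (simp add: all_final_at_def)
qed

lemma running_time_padded:
  assumes "well_formed M" "oracles padded As" "x \<in> inputs M" "halts_in_time M [As ! 0] x T"
  shows "halts_in_time padded As x (7 * T)" "running_time padded As x = 7 * T"
proof -
  have fin: "all_final_at M [As ! 0] x T"
    using assms(4) unfolding halts_in_time_def running_time_def by (metis LeastI)
  have least: "T \<le> t" if "all_final_at M [As ! 0] x t" for t
    using assms(4) that unfolding halts_in_time_def running_time_def by (metis Least_le)
  have fin': "all_final_at padded As x (7 * T)" using fin all_final_at_padded[OF assms(3)] by simp
  have "7 * T \<le> s" if "all_final_at padded As x s" for s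
  proof -
    have "7 dvd s" using assms(1-3) that by (rule all_final_at_padded_dvd)
    then obtain t where "s = 7 * t" by (rule dvdE)
    then show ?thesis using that least all_final_at_padded[OF assms(3)] by simp
  qed
  then show "running_time padded As x = 7 * T"
    unfolding running_time_def using fin' by (intro Least_equality)
  then show "halts_in_time padded As x (7 * T)" using fin' unfolding halts_in_time_def by blast
qed

text \<open>The output tape is among the first \<open>k + 1\<close> tapes, which
  \<open>traj 0\<close> copies, and its injectivity leaves each amplitude unchanged.\<close>

lemma accept_prob_padded:
  assumes "well_formed M" "oracles padded As" "x \<in> inputs M" "halts_in_time M [As ! 0] x T"
  shows "accept_prob padded As x = accept_prob M [As ! 0] x"
proof -
  define \<phi> where "\<phi> = superpos_at M [As ! 0] x T"
  have \<phi>: "finite (supp \<phi>)" "supp \<phi> \<subseteq> configs M"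
    using superpos_at_in_superpositions[OF machine initial_in_configs[OF machine assms(3)]]
    by (auto simp: superpositions_iff \<phi>_def)
  have inj: "inj_on (traj 0) (supp \<phi>)" using traj_0_inj \<phi>(2) by (rule inj_on_subset)
  have pushed: "superpos_at padded As x (7 * T) = push (traj 0) \<phi>"
    using superpos_at_padded[OF assms(3), of 0 As T] by (simp add: \<phi>_def)
  let ?acc = "\<lambda>c. (tapes c ! out M) 0 = Bit True"
  have acc: "?acc (traj 0 c) \<longleftrightarrow> ?acc c" if "c \<in> supp \<phi>" for c
    using that \<phi>(2) out_M by (auto simp: traj_def glue_def configs_M_iff core_def nth_append)
  have set: "{c. push (traj 0) \<phi> c \<noteq> 0 \<and> ?acc c} = traj 0 ` {c \<in> supp \<phi>. ?acc c}"
    using supp_push[OF inj \<phi>(1)] acc by (auto simp: supp_def set_eq_iff image_iff)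
  have "accept_prob padded As x = (\<Sum>c\<in>traj 0 ` {c \<in> supp \<phi>. ?acc c}. (cmod (push (traj 0) \<phi> c))\<^sup>2)"
    unfolding accept_prob_def running_time_padded(2)[OF assms] pushed Let_def padded_simps set ..
  also have "\<dots> = (\<Sum>c\<in>{c \<in> supp \<phi>. ?acc c}. (cmod (\<phi> c))\<^sup>2)"
    using inj \<phi>(1)
    by (subst sum.reindex) (auto simp: push_apply insert_absorb intro: inj_on_subset)
  also have "\<dots> = accept_prob M [As ! 0] x"
    using assms(4) by (simp add: accept_prob_def halts_in_time_def \<phi>_def supp_def Let_def)
  finally show ?thesis .
qed

section \<open>Queries along computation paths\<close>

lemma traj_pre_iff:
  assumes "c \<in> configs M" "j < 7"
  shows "cstate (traj j c) \<in> set (pre padded) \<longleftrightarrow> j = (if cstate c = qp then 6 else 4)"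
  using assms qp by (auto simp: traj_def code_eq_iff configs_M_iff)

text \<open>A path may run through configurations whose amplitudes cancel in the superposition, so
  the path itself is followed: inside a block each successor is forced, and after level 6 it must
  lie in the image of \<open>traj 0\<close>.\<close>

lemma computation_path_padded:
  assumes path: "\<forall>i<7 * T. step padded As (cs ! i) (cs ! Suc i) \<noteq> 0"
    and start: "cs ! 0 = traj 0 c" "c \<in> configs M"
    and "7 * t + j < 7 * T" "j < 7"
  shows "\<exists>c\<in>configs M. \<forall>i\<le>j. cs ! (7 * t + i) = traj i c"
  using assms(4,5)
proof (induction "7 * t + j" arbitrary: t j rule: less_induct)
  case less
  consider "t = 0" "j = 0" | i where "j = Suc i" | r where "t = Suc r" "j = 0"
    by (metis not0_implies_Suc)
  then show ?case
  proof cases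
    case 1
    then show ?thesis using start by auto
  next
    case 2
    have "\<exists>c\<in>configs M. \<forall>i'\<le>i. cs ! (7 * t + i') = traj i' c"
      using 2 less.prems by (intro less.hyps) simp_all
    then obtain c where c: "c \<in> configs M" "\<forall>i'\<le>i. cs ! (7 * t + i') = traj i' c" by blast
    have "step padded As (traj i c) (cs ! (7 * t + j)) \<noteq> 0"
      using path[rule_format, of "7 * t + i"] c(2) 2 less.prems by simp
    then have "cs ! (7 * t + j) = traj j c"
      using c(1) 2 less.prems by (simp add: step_traj ket_def split: if_splits)
    then show ?thesis using c 2 by (auto simp: le_Suc_eq)
  next
    case 3
    have "\<exists>c\<in>configs M. \<forall>i\<le>6. cs ! (7 * r + i) = traj i c"
      using 3 less.prems by (intro less.hyps) simp_all
    then obtain c where c: "c \<in> configs M" "cs ! (7 * r + 6) = traj 6 c" by blast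
    have "Suc (7 * r + 6) = 7 * t" using 3 by simp
    then have "push (traj 0) (step M [As ! 0] c) (cs ! (7 * t)) \<noteq> 0"
      using path[rule_format, of "7 * r + 6"] c less.prems step_traj_6[OF c(1), of As] by simp
    then have "cs ! (7 * t) \<in> traj 0 ` supp (step M [As ! 0] c)"
      using supp_push_subset by (force simp: supp_def)
    then show ?thesis using supp_step(2)[OF machine c(1)] 3 by auto
  qed
qed

lemma path_queries_padded:
  assumes "running_time padded As x = 7 * T" "x \<in> inputs M" "computation_path padded As x cs"
  shows "path_queries padded As x cs = T"
proof -
  define P where "P = (\<lambda>i. cstate (cs ! i) \<in> set (pre padded))"
  have path: "\<forall>i<7 * T. step padded As (cs ! i) (cs ! Suc i) \<noteq> 0"
    and start: "cs ! 0 = traj 0 (initial M x)"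
    using assms by (auto simp: computation_path_def traj_initial)
  have "\<exists>d<7. \<forall>j<7. P (7 * t + j) \<longleftrightarrow> j = d" if "t < T" for t
  proof -
    have "7 * t + 6 < 7 * T" using that by simp
    then obtain c where c: "c \<in> configs M" "\<forall>i\<le>6. cs ! (7 * t + i) = traj i c"
      using computation_path_padded[OF path start initial_in_configs[OF machine assms(2)], of t 6]
      by auto
    \<comment> \<open>Index 6 is the genuine query made from \<open>qp\<close>, index 4 the dummy
      query of any other state.\<close>
    have "\<forall>j<7. P (7 * t + j) \<longleftrightarrow> j = (if cstate c = qp then 6 else 4)"
      using c traj_pre_iff[OF c(1)] by (simp add: P_def)
    then show ?thesis by (intro exI[of _ "if cstate c = qp then 6 else 4"]) simp
  qed
  then have "card {i. i < 7 * T \<and> P i} = T"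
  proof (induction T)
    case (Suc T)
    \<comment> \<open>The last block contributes exactly the index \<open>7 * T + d\<close> to the
      counted set.\<close>
    obtain d where d: "d < 7" "\<forall>j<7. P (7 * T + j) \<longleftrightarrow> j = d" using Suc.prems[of T] by auto
    have "i < 7 * Suc T \<and> P i \<longleftrightarrow> i < 7 * T \<and> P i \<or> i = 7 * T + d" for i
    proof (cases "i < 7 * T")
      case False
      then obtain j where "i = 7 * T + j" by (metis le_Suc_ex not_less)
      then show ?thesis using d by auto
    qed auto
    then have "{i. i < 7 * Suc T \<and> P i} = insert (7 * T + d) {i. i < 7 * T \<and> P i}" by blast
    moreover have "finite {i. i < 7 * T \<and> P i}" by simp
    ultimately show ?case using Suc by simp
  qed simp
  then show ?thesis by (simp add: path_queries_def assms(1) P_def)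
qed

end

theorem lemma8:
  fixes M :: "'q oqtm" and k :: nat and A :: "symbol list set"
    and T :: "symbol list list \<Rightarrow> nat"
  assumes "oracle_qtm k 1 M"
    and "well_formed M"
    and "normal_form M"
    and "oracles M [A]"
    and "\<forall>x\<in>inputs M. halts_in_time M [A] x (T x)"
  shows "\<exists>M' :: nat oqtm.
    oracle_qtm k 2 M' \<and> well_formed M' \<and> oracles M' [A, A] \<and>
    (\<forall>x\<in>inputs M. x \<in> inputs M' \<and>
       halts_in_time M' [A, A] x (7 * T x) \<and>
       (\<forall>cs. computation_path M' [A, A] x cs \<longrightarrow> path_queries M' [A, A] x cs = T x) \<and>
       accept_prob M' [A, A] x = accept_prob M [A] x)"
proof -
  have "finite (states M)" using assms(1) by (simp add: oracle_qtm_def)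
  then obtain e :: "'q \<Rightarrow> nat" where "inj_on e (states M)"
    using finite_imp_inj_to_nat_seg by metis
  then interpret padding M k e using assms(1) by unfold_locales
  have "A \<subseteq> lists (alph M ! k)" using assms(4) by (simp add: oracles_def)
  then have "oracles padded [A, A]"
    by (auto simp: oracles_def nth_append alph_M less_2_cases_iff aux_def)
  \<comment> \<open>The general results compare with \<open>M\<close> run on
    \<open>[As ! 0]\<close>, which for \<open>[A, A]\<close> is the given oracle.\<close>
  then have "x \<in> inputs padded \<and> halts_in_time padded [A, A] x (7 * T x) \<and>
      (\<forall>cs. computation_path padded [A, A] x cs \<longrightarrow> path_queries padded [A, A] x cs = T x) \<and>
      accept_prob padded [A, A] x = accept_prob M [A] x" if "x \<in> inputs M" for x
    using running_time_padded[of "[A, A]" x "T x"] accept_prob_padded[of "[A, A]" x "T x"]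
      path_queries_padded[of "[A, A]" x "T x"] inputs_padded[OF that] assms(2,5) that by simp
  then show ?thesis
    using oracle_qtm_padded well_formed_padded[OF assms(2)] \<open>oracles padded [A, A]\<close> by blast
qed

end
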